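(* Let $n,k>0$ be integers, let $\Delta_n$ be a knot sequence on $[0,1]$ as in the context, and let $S_{\Delta_n,k}:C([0,1])\to C([0,1])$ be the associated Schoenberg operator. Then the spectrum of $S_{\Delta_n,k}$ consists only of the point spectrum, i.e. $\sigma(S_{\Delta_n,k})=\sigma_p(S_{\Delta_n,k})$, and $$\sigma(S_{\Delta_n,k})\subset\{\lambda\in\mathbb C : |\lambda|<1\}\cup\{1\}.$$
   Context: $C([0,1])$ is the Banach space of real-valued continuous functions on $[0,1]$ with the uniform norm $\|\cdot\|_\infty$. Knots: for integers $n,k>0$, $\Delta_n=\{x_j\}_{j=-k}^{n+k}$ satisfies $x_{-k}=\cdots=x_0=0<x_1<\cdots<x_n=\cdots=x_{n+k}=1$. Normalized B-splines of degree $k$: for $-k\le j\le n-1$, $N_{j,k}(x)=(x_{j+k+1}-x_j)\,[x_j,\ldots,x_{j+k+1}](\cdot-x)_+^k$, where $y_+^k=y^k$ for $y>0$ and $0$ for $y\le0$, and $[x_j,\ldots,x_{j+k+1}]g$ is the divided difference, i.e. the leading coefficient (of degree $k+1$) of the polynomial of degree at most $k+1$ interpolating $g$ at $x_j,\ldots,x_{j+k+1}$ (Hermite interpolation at repeated points); the value at $x=0$ is the right limit. Greville nodes: $\xi_{j,k}=\frac{x_{j+1}+\cdots+x_{j+k}}{k}$, $-k\le j\le n-1$. Schoenberg operator: $S_{\Delta_n,k}f(x)=\sum_{j=-k}^{n-1}f(\xi_{j,k})N_{j,k}(x)$ for $0\le x<1$, and $S_{\Delta_n,k}f(1)=\lim_{y\nearrow1}S_{\Delta_n,k}f(y)$.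 For a bounded linear operator $T$ on $C([0,1])$, $\sigma(T)=\{\lambda\in\mathbb C: T-\lambda I\text{ is not invertible}\}$ and $\sigma_p(T)=\{\lambda\in\mathbb C: T-\lambda I\text{ is not one-to-one}\}$, where for complex $\lambda$ the operator is understood on the complexification of $C([0,1])$ (complex-valued continuous functions). *)

theory Defs
  imports "HOL-Analysis.Analysis" "HOL-Computational_Algebra.Polynomial"
begin

section \<open>The space of continuous functions on the unit interval\<close>

typedef unit_interval = "{0..1::real}"
  morphisms real_of_unit unit_of_real
  by (intro exI[of _ 0]) auto

instantiation unit_interval :: metric_space
begin

definition dist_unit_interval :: "unit_interval \<Rightarrow> unit_interval \<Rightarrow> real" where
  "dist_unit_interval s t = dist (real_of_unit s) (real_of_unit t)"

definition uniformity_unit_interval :: "(unit_interval \<times> unit_interval) filter" where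
  "uniformity_unit_interval = (INF e\<in>{0<..}. principal {(s, t). dist s t < e})"

definition open_unit_interval :: "unit_interval set \<Rightarrow> bool" where
  "open_unit_interval U = (\<forall>s\<in>U. \<forall>\<^sub>F (s', t) in uniformity. s' = s \<longrightarrow> t \<in> U)"

instance
proof
  fix s t u :: unit_interval
  show "dist s t = 0 \<longleftrightarrow> s = t"
    by (simp add: dist_unit_interval_def real_of_unit_inject)
  show "dist s t \<le> dist s u + dist t u"
    by (simp add: dist_unit_interval_def dist_triangle2)
qed (rule open_unit_interval_def uniformity_unit_interval_def)+

end

lemma continuous_on_real_of_unit [continuous_intros]: "continuous_on A real_of_unit"
  by (auto simp: continuous_on_iff dist_unit_interval_def)

lemma continuous_on_unit_of_real: "continuous_on {0..1} unit_of_real"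
  by (auto simp: continuous_on_iff dist_unit_interval_def unit_of_real_inverse)

lemma compact_UNIV_unit_interval: "compact (UNIV :: unit_interval set)"
proof -
  have "unit_of_real ` {0..1} = UNIV"
    by (metis type_definition.Abs_image type_definition_unit_interval)
  with compact_continuous_image[OF continuous_on_unit_of_real] show ?thesis by simp
qed

text \<open>Since the unit interval is compact, every continuous function on it is bounded, so
  the library type of bounded continuous functions with the supremum norm is the Banach space
  of continuous functions on [0,1].\<close>

lemma bcontfun_unit_interval_iff:
  fixes f :: "unit_interval \<Rightarrow> 'b::metric_space"
  shows "f \<in> bcontfun \<longleftrightarrow> continuous_on UNIV f"
  using compact_continuous_image[OF _ compact_UNIV_unit_interval, of f]
  by (auto simp: bcontfun_def intro: compact_imp_bounded)


section \<open>Complexification and spectrum\<close>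

context
  includes bcontfun.lifting
begin

lift_definition bcontfun_Re :: "('a::topological_space \<Rightarrow>\<^sub>C complex) \<Rightarrow> ('a \<Rightarrow>\<^sub>C real)"
  is "\<lambda>f x. Re (f x)"
  by (auto simp: bcontfun_def bounded_iff intro!: continuous_intros)
    (meson abs_Re_le_cmod order_trans)

lift_definition bcontfun_Im :: "('a::topological_space \<Rightarrow>\<^sub>C complex) \<Rightarrow> ('a \<Rightarrow>\<^sub>C real)"
  is "\<lambda>f x. Im (f x)"
  by (auto simp: bcontfun_def bounded_iff intro!: continuous_intros)
    (meson abs_Im_le_cmod order_trans)

lift_definition bcontfun_Complex ::
    "('a::topological_space \<Rightarrow>\<^sub>C real) \<Rightarrow> ('a \<Rightarrow>\<^sub>C real) \<Rightarrow> ('a \<Rightarrow>\<^sub>C complex)"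
  is "\<lambda>f g x. Complex (f x) (g x)"
proof -
  fix f g :: "'a \<Rightarrow> real"
  assume f: "f \<in> bcontfun" and g: "g \<in> bcontfun"
  have "continuous_on UNIV (\<lambda>x. Complex (f x) (g x))"
    using f g by (auto simp: bcontfun_def Complex_eq intro!: continuous_intros)
  moreover obtain a b where "\<And>x. \<bar>f x\<bar> \<le> a" "\<And>x. \<bar>g x\<bar> \<le> b"
    using f g by (auto simp: bcontfun_def bounded_iff)
  then have "cmod (Complex (f x) (g x)) \<le> a + b" for x
    using cmod_le[of "Complex (f x) (g x)"] by (smt (verit) complex.sel)
  then have "bounded (range (\<lambda>x. Complex (f x) (g x)))"
    by (auto simp: bounded_iff)
  ultimately show "(\<lambda>x. Complex (f x) (g x)) \<in> bcontfun"
    by (simp add: bcontfun_def)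
qed

lift_definition bcontfun_scaleC ::
    "complex \<Rightarrow> ('a::topological_space \<Rightarrow>\<^sub>C complex) \<Rightarrow> ('a \<Rightarrow>\<^sub>C complex)"
  is "\<lambda>c f x. c * f x"
proof -
  fix c and f :: "'a \<Rightarrow> complex"
  assume f: "f \<in> bcontfun"
  then obtain a where a: "\<And>x. cmod (f x) \<le> a"
    by (auto simp: bcontfun_def bounded_iff)
  show "(\<lambda>x. c * f x) \<in> bcontfun"
    using f a by (intro bcontfun_normI[where b = "cmod c * a"])
      (auto simp: bcontfun_def norm_mult intro!: continuous_intros mult_left_mono)
qed

end

definition complexify ::
    "(('a::topological_space \<Rightarrow>\<^sub>C real) \<Rightarrow> ('a \<Rightarrow>\<^sub>C real)) \<Rightarrow> ('a \<Rightarrow>\<^sub>C complex) \<Rightarrow> ('a \<Rightarrow>\<^sub>C complex)"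
  where "complexify T f = bcontfun_Complex (T (bcontfun_Re f)) (T (bcontfun_Im f))"

definition bounded_clinear ::
    "(('a::topological_space \<Rightarrow>\<^sub>C complex) \<Rightarrow> ('a \<Rightarrow>\<^sub>C complex)) \<Rightarrow> bool"
  where "bounded_clinear R \<longleftrightarrow>
    bounded_linear R \<and> (\<forall>c f. R (bcontfun_scaleC c f) = bcontfun_scaleC c (R f))"

definition invertible_op ::
    "(('a::topological_space \<Rightarrow>\<^sub>C complex) \<Rightarrow> ('a \<Rightarrow>\<^sub>C complex)) \<Rightarrow> bool"
  where "invertible_op A \<longleftrightarrow> (\<exists>R. bounded_clinear R \<and> R \<circ> A = id \<and> A \<circ> R = id)"

definition shifted_op ::
    "(('a::topological_space \<Rightarrow>\<^sub>C real) \<Rightarrow> ('a \<Rightarrow>\<^sub>C real)) \<Rightarrow> complex \<Rightarrow> ('a \<Rightarrow>\<^sub>C complex) \<Rightarrow> ('a \<Rightarrow>\<^sub>C complex)"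
  where "shifted_op T l f = complexify T f - bcontfun_scaleC l f"

definition spectrum ::
    "(('a::topological_space \<Rightarrow>\<^sub>C real) \<Rightarrow> ('a \<Rightarrow>\<^sub>C real)) \<Rightarrow> complex set"
  where "spectrum T = {l. \<not> invertible_op (shifted_op T l)}"

definition point_spectrum ::
    "(('a::topological_space \<Rightarrow>\<^sub>C real) \<Rightarrow> ('a \<Rightarrow>\<^sub>C real)) \<Rightarrow> complex set"
  where "point_spectrum T = {l. \<not> inj (shifted_op T l)}"


section \<open>Divided differences\<close>

text \<open>The node list may contain repetitions: a node of multiplicity m carries the
  interpolation conditions for the derivatives of orders 0, ..., m - 1.\<close>

definition hermite_interpolates :: "real list \<Rightarrow> (real \<Rightarrow> real) \<Rightarrow> real poly \<Rightarrow> bool" where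
  "hermite_interpolates ts g p \<longleftrightarrow>
    (\<forall>t\<in>set ts. \<forall>i<count_list ts t. poly ((pderiv ^^ i) p) t = (deriv ^^ i) g t)"

definition divided_difference :: "real list \<Rightarrow> (real \<Rightarrow> real) \<Rightarrow> real" where
  "divided_difference ts g =
    coeff (THE p. degree p < length ts \<and> hermite_interpolates ts g p) (length ts - 1)"


section \<open>B-splines and the Schoenberg operator\<close>

definition knot_sequence :: "nat \<Rightarrow> nat \<Rightarrow> (int \<Rightarrow> real) \<Rightarrow> bool" where
  "knot_sequence n k x \<longleftrightarrow>
    (\<forall>j\<in>{- int k..0}. x j = 0) \<and> (\<forall>j\<in>{int n..int n + int k}. x j = 1) \<and>
    strict_mono_on {0..int n} x"

definition trunc_power :: "nat \<Rightarrow> real \<Rightarrow> real" where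
  "trunc_power k y = (if y > 0 then y ^ k else 0)"

definition bspline_pre :: "nat \<Rightarrow> (int \<Rightarrow> real) \<Rightarrow> int \<Rightarrow> real \<Rightarrow> real" where
  "bspline_pre k x j y =
    (x (j + int k + 1) - x j) *
      divided_difference (map x [j..j + int k + 1]) (\<lambda>t. trunc_power k (t - y))"

text \<open>At the point 0 the truncated power is not smooth enough for a knot of multiplicity
  k + 1 at 0; the value there is the right limit.\<close>

definition bspline :: "nat \<Rightarrow> (int \<Rightarrow> real) \<Rightarrow> int \<Rightarrow> real \<Rightarrow> real" where
  "bspline k x j y = (if y = 0 then Lim (at_right 0) (bspline_pre k x j) else bspline_pre k x j y)"

definition greville :: "nat \<Rightarrow> (int \<Rightarrow> real) \<Rightarrow> int \<Rightarrow> real" where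
  "greville k x j = (\<Sum>i=j+1..j + int k. x i) / real k"

definition schoenberg_sum ::
    "nat \<Rightarrow> nat \<Rightarrow> (int \<Rightarrow> real) \<Rightarrow> (unit_interval \<Rightarrow>\<^sub>C real) \<Rightarrow> real \<Rightarrow> real" where
  "schoenberg_sum n k x f y =
    (\<Sum>j=- int k..int n - 1. apply_bcontfun f (unit_of_real (greville k x j)) * bspline k x j y)"

definition schoenberg_fun ::
    "nat \<Rightarrow> nat \<Rightarrow> (int \<Rightarrow> real) \<Rightarrow> (unit_interval \<Rightarrow>\<^sub>C real) \<Rightarrow> real \<Rightarrow> real" where
  "schoenberg_fun n k x f y =
    (if y < 1 then schoenberg_sum n k x f y else Lim (at_left 1) (schoenberg_sum n k x f))"

text \<open>For a knot sequence the function passed to \<open>Bcontfun\<close> is continuous, see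
  \<open>apply_schoenberg\<close> below; likewise the Greville nodes lie in [0,1].\<close>

definition schoenberg ::
    "nat \<Rightarrow> nat \<Rightarrow> (int \<Rightarrow> real) \<Rightarrow> (unit_interval \<Rightarrow>\<^sub>C real) \<Rightarrow> (unit_interval \<Rightarrow>\<^sub>C real)" where
  "schoenberg n k x f = Bcontfun (\<lambda>t. schoenberg_fun n k x f (real_of_unit t))"


section \<open>Well-definedness\<close>

lemma higher_pderiv_order:
  fixes p :: "real poly"
  assumes "p \<noteq> 0"
  shows "n \<le> order a p \<longleftrightarrow> (\<forall>i<n. poly ((pderiv ^^ i) p) a = 0)"
  using assms
proof (induction n arbitrary: p)
  case 0
  then show ?case by simp
next
  case (Suc n)
  have split: "(\<forall>i<Suc n. poly ((pderiv ^^ i) p) a = 0) \<longleftrightarrow>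
      poly p a = 0 \<and> (\<forall>i<n. poly ((pderiv ^^ i) (pderiv p)) a = 0)"
    by (auto simp: less_Suc_eq_0_disj funpow_swap1)
  show ?case
  proof (cases "poly p a = 0")
    case False
    then show ?thesis using Suc.prems by (auto simp: split order_root)
  next
    case True
    with Suc.prems have "order a p = Suc (order a (pderiv p))"
      by (rule order_pderiv)
    moreover have "pderiv p \<noteq> 0"
      using True Suc.prems by (auto dest!: pderiv_iszero)
    ultimately show ?thesis using Suc.IH[of "pderiv p"] True by (simp add: split)
  qed
qed

definition node_poly :: "real list \<Rightarrow> real poly" where
  "node_poly ts = (\<Prod>t\<leftarrow>ts. [:- t, 1:])"

lemma node_poly_simps [simp]:
  "node_poly [] = 1" "node_poly (t # ts) = [:- t, 1:] * node_poly ts"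
  by (simp_all add: node_poly_def)

lemma node_poly_nonzero [simp]: "node_poly ts \<noteq> 0"
  by (induction ts) (auto simp del: mult_pCons_left)

lemma degree_node_poly [simp]: "degree (node_poly ts) = length ts"
proof (induction ts)
  case (Cons t ts)
  have "degree ([:- t, 1:] * node_poly ts) = degree [:- t, 1:] + degree (node_poly ts)"
    by (rule degree_mult_eq) auto
  then show ?case by (simp add: Cons.IH del: mult_pCons_left)
qed simp

lemma order_linear_real: "order a [:- t, 1:] = (if t = (a::real) then 1 else 0)"
  using order_power_n_n[of a 1] by (auto intro!: order_0I)

lemma order_node_poly: "order a (node_poly ts) = count_list ts a"
proof (induction ts)
  case (Cons t ts)
  have "order a (node_poly (t # ts)) = order a [:- t, 1:] + order a (node_poly ts)"
    unfolding node_poly_simps by (rule order_mult) (metis mult_eq_0_iff node_poly_nonzero one_neq_zero pCons_eq_0_iff)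
  then show ?case by (simp add: Cons.IH order_linear_real del: node_poly_simps)
qed (auto intro!: order_0I)

lemma node_poly_dvd:
  assumes "d \<noteq> 0" "\<And>t. t \<in> set ts \<Longrightarrow> count_list ts t \<le> order t d"
  shows "node_poly ts dvd d"
  using assms(2)
proof (induction ts)
  case (Cons a ts)
  have "count_list ts t \<le> order t d" if "t \<in> set ts" for t
    using Cons.prems[of t] that by (auto split: if_splits)
  then obtain e where e: "d = node_poly ts * e"
    using Cons.IH by (auto elim: dvdE)
  have "order a d = count_list ts a + order a e"
    using assms(1) e by (simp add: order_mult order_node_poly)
  with Cons.prems[of a] have "order a e \<noteq> 0" by auto
  then have "poly e a = 0" by (metis order_root)
  then have "[:- a, 1:] dvd e" by (simp add: poly_eq_0_iff_dvd)
  then show ?case unfolding e node_poly_simps by (metis mult.commute mult_dvd_mono dvd_refl)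
qed simp

definition interp_data :: "real list \<Rightarrow> (nat \<Rightarrow> real \<Rightarrow> real) \<Rightarrow> real poly \<Rightarrow> bool" where
  "interp_data ts D p \<longleftrightarrow> degree p < length ts \<and>
    (\<forall>t\<in>set ts. \<forall>i<count_list ts t. poly ((pderiv ^^ i) p) t = D i t)"

lemma higher_pderiv_diff_real:
  "(pderiv ^^ n) (p - q) = (pderiv ^^ n) p - (pderiv ^^ n) (q :: real poly)"
  using higher_pderiv_add[of n "p - q" q] by simp

lemma interp_data_unique:
  assumes "interp_data ts D p" "interp_data ts D q"
  shows "p = q"
proof (rule ccontr)
  assume "p \<noteq> q"
  define d where "d = p - q"
  have d0: "d \<noteq> 0" using \<open>p \<noteq> q\<close> by (simp add: d_def)
  have "count_list ts t \<le> order t d" if "t \<in> set ts" for t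
    using assms that unfolding higher_pderiv_order[OF d0]
    by (auto simp: interp_data_def d_def higher_pderiv_diff_real)
  with d0 have "node_poly ts dvd d" by (rule node_poly_dvd)
  then have "length ts \<le> degree d" using d0 dvd_imp_degree_le by fastforce
  moreover have "degree d < length ts"
    using assms unfolding interp_data_def d_def by (intro degree_diff_less) auto
  ultimately show False by simp
qed

lemma interp_data_exists:
  assumes "ts \<noteq> []"
  shows "\<exists>p. interp_data ts D p"
proof -
  have "\<exists>p. (p = 0 \<or> degree p < length ts) \<and>
    (\<forall>t\<in>set ts. \<forall>i<count_list ts t. poly ((pderiv ^^ i) p) t = D i t)"
  proof (induction ts)
    case (Cons a ts)
    then obtain p where deg: "p = 0 \<or> degree p < length ts"
      and p: "\<And>t i. t \<in> set ts \<Longrightarrow> i < count_list ts t \<Longrightarrow> poly ((pderiv ^^ i) p) t = D i t"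
      by blast
    let ?w = "node_poly ts" and ?m = "count_list ts a"
    have w0: "poly ((pderiv ^^ i) ?w) t = 0" if "i < count_list ts t" for t i
      using that higher_pderiv_order[of ?w "count_list ts t" t] by (simp add: order_node_poly)
    have "\<not> Suc ?m \<le> order a ?w" by (simp add: order_node_poly)
    then have wm: "poly ((pderiv ^^ ?m) ?w) a \<noteq> 0"
      unfolding higher_pderiv_order[OF node_poly_nonzero] using w0 by (metis less_antisym)
    define c where "c = (D ?m a - poly ((pderiv ^^ ?m) p) a) / poly ((pderiv ^^ ?m) ?w) a"
    let ?q = "p + smult c ?w"
    have "degree ?q \<le> length ts"
      using deg by (intro degree_add_le) auto
    moreover have "poly ((pderiv ^^ i) ?q) t = D i t"
      if "t \<in> set (a # ts)" "i < count_list (a # ts) t" for t i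
    proof (cases "i < count_list ts t")
      case True
      then have "t \<in> set ts" by (metis count_notin not_less_zero)
      then show ?thesis using True p w0 by (simp add: higher_pderiv_add higher_pderiv_smult)
    next
      case False
      with that have "t = a" "i = ?m" by (auto split: if_splits)
      then show ?thesis using wm by (simp add: higher_pderiv_add higher_pderiv_smult c_def)
    qed
    ultimately show ?case by (intro exI[of _ ?q]) auto
  qed simp
  then obtain p where "p = 0 \<or> degree p < length ts"
    "\<forall>t\<in>set ts. \<forall>i<count_list ts t. poly ((pderiv ^^ i) p) t = D i t"
    by blast
  then show ?thesis using assms by (intro exI[of _ p]) (auto simp: interp_data_def)
qed

lemma interp_data_coeff_linear:
  assumes "ts \<noteq> []"
  obtains W where "\<And>D p. interp_data ts D p \<Longrightarrow>
    coeff p (length ts - 1) = (\<Sum>t\<in>set ts. \<Sum>i<count_list ts t. D i t * W t i)"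
proof -
  have "\<forall>s l. \<exists>q. interp_data ts (\<lambda>i t. if i = l \<and> t = s then 1 else 0) q"
    using interp_data_exists[OF assms] by blast
  then obtain Q where Q: "\<And>s l. interp_data ts (\<lambda>i t. if i = l \<and> t = s then 1 else 0) (Q s l)"
    by metis
  have "coeff p (length ts - 1) =
      (\<Sum>t\<in>set ts. \<Sum>i<count_list ts t. D i t * coeff (Q t i) (length ts - 1))"
    if p: "interp_data ts D p" for D p
  proof -
    let ?q = "\<Sum>s\<in>set ts. \<Sum>l<count_list ts s. smult (D l s) (Q s l)"
    have "degree ?q \<le> length ts - 1"
    proof (intro degree_sum_le finite_set finite_lessThan)
      fix s l
      have "degree (Q s l) \<le> length ts - 1"
        using Q[where s = s and l = l] by (auto simp: interp_data_def)
      then show "degree (smult (D l s) (Q s l)) \<le> length ts - 1"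
        using degree_smult_le order_trans by blast
    qed
    then have deg: "degree ?q < length ts" using assms by (cases ts) auto
    have "poly ((pderiv ^^ i) ?q) t = D i t" if t: "t \<in> set ts" "i < count_list ts t" for t i
    proof -
      have "poly ((pderiv ^^ i) ?q) t =
          (\<Sum>s\<in>set ts. \<Sum>l<count_list ts s. D l s * poly ((pderiv ^^ i) (Q s l)) t)"
        by (simp add: higher_pderiv_sum higher_pderiv_smult poly_sum)
      also have "\<dots> = (\<Sum>s\<in>set ts. \<Sum>l<count_list ts s. if s = t \<and> l = i then D i t else 0)"
        using Q t by (intro sum.cong refl) (auto simp: interp_data_def)
      also have "\<dots> = (\<Sum>s\<in>set ts. if s = t then D i t else 0)"
        using t by (intro sum.cong refl) auto
      also have "\<dots> = D i t" using t by simp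
      finally show ?thesis .
    qed
    with deg have "interp_data ts D ?q" by (auto simp: interp_data_def)
    with p have "p = ?q" by (rule interp_data_unique)
    then show ?thesis by (simp add: coeff_sum)
  qed
  then show thesis by (rule that)
qed

lemma divided_difference_linear:
  assumes "ts \<noteq> []"
  obtains W where "\<And>g. divided_difference ts g =
    (\<Sum>t\<in>set ts. \<Sum>i<count_list ts t. (deriv ^^ i) g t * W t i)"
proof -
  obtain W where W: "\<And>D p. interp_data ts D p \<Longrightarrow>
      coeff p (length ts - 1) = (\<Sum>t\<in>set ts. \<Sum>i<count_list ts t. D i t * W t i)"
    using interp_data_coeff_linear[OF assms] by blast
  have "divided_difference ts g = (\<Sum>t\<in>set ts. \<Sum>i<count_list ts t. (deriv ^^ i) g t * W t i)" for g
  proof -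
    let ?P = "interp_data ts (\<lambda>i. (deriv ^^ i) g)"
    have eq: "(THE p. degree p < length ts \<and> hermite_interpolates ts g p) = (THE p. ?P p)"
      by (simp add: interp_data_def hermite_interpolates_def)
    have "?P (THE p. ?P p)"
      using interp_data_exists[OF assms] interp_data_unique by (metis (no_types, lifting) theI)
    from W[OF this] show ?thesis by (simp add: divided_difference_def eq)
  qed
  then show thesis by (rule that)
qed

lemma higher_deriv_trunc_power:
  assumes "t \<noteq> y"
  shows "(deriv ^^ i) (\<lambda>t. trunc_power k (t - y)) t =
    (if t > y then (\<Prod>l<i. real k - real l) * (t - y) ^ (k - i) else 0)"
  using assms
proof (induction i arbitrary: t)
  case 0
  then show ?case by (simp add: trunc_power_def)
next
  case (Suc i)
  let ?F = "(deriv ^^ i) (\<lambda>t. trunc_power k (t - y))"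
  let ?c = "\<Prod>l<i. real k - real l"
  have ev: "eventually (\<lambda>s. ?F s = (if t > y then ?c * (s - y) ^ (k - i) else 0)) (nhds t)"
  proof (cases "t > y")
    case True
    then have "eventually (\<lambda>s. s \<in> {y<..}) (nhds t)" by (intro eventually_nhds_in_open) auto
    then show ?thesis by eventually_elim (use True Suc.IH in auto)
  next
    case False
    with Suc.prems have "eventually (\<lambda>s. s \<in> {..<y}) (nhds t)"
      by (intro eventually_nhds_in_open) auto
    then show ?thesis by eventually_elim (use False Suc.IH in auto)
  qed
  have "(deriv ^^ Suc i) (\<lambda>t. trunc_power k (t - y)) t = deriv ?F t" by simp
  also have "\<dots> = deriv (\<lambda>s. if t > y then ?c * (s - y) ^ (k - i) else 0) t"
    using ev by (rule deriv_cong_ev) simp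
  also have "\<dots> = (if t > y then (\<Prod>l<Suc i. real k - real l) * (t - y) ^ (k - Suc i) else 0)"
  proof (cases "t > y")
    case True
    have "((\<lambda>s. ?c * (s - y) ^ (k - i)) has_real_derivative
        ?c * (real (k - i) * (t - y) ^ (k - i - 1))) (at t)"
      by (auto intro!: derivative_eq_intros)
    moreover have "?c * (real (k - i) * (t - y) ^ (k - i - 1)) =
        (\<Prod>l<Suc i. real k - real l) * (t - y) ^ (k - Suc i)"
    proof (cases "i \<le> k")
      case True
      then show ?thesis by (simp add: of_nat_diff)
    next
      case False
      then have "?c = 0" by (intro prod_zero) (auto intro!: bexI[of _ k])
      then show ?thesis by simp
    qed
    ultimately show ?thesis using True by (simp add: DERIV_imp_deriv)
  next
    case False
    then show ?thesis by simp
  qed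
  finally show ?case .
qed

lemma knot_sequence_cases:
  assumes "knot_sequence n k x" "i \<in> {- int k..int n + int k}"
  obtains "i \<le> 0" "x i = 0" | "i \<in> {0<..<int n}" "0 < x i" "x i < 1" | "i \<ge> int n" "x i = 1"
proof -
  have k: "x j = 0" if "j \<in> {- int k..0}" for j
    using assms(1) that by (auto simp: knot_sequence_def)
  have k1: "x j = 1" if "j \<in> {int n..int n + int k}" for j
    using assms(1) that by (auto simp: knot_sequence_def)
  have mono: "x a < x b" if "0 \<le> a" "a < b" "b \<le> int n" for a b
    using assms(1) that by (auto simp: knot_sequence_def strict_mono_on_def)
  consider "i \<le> 0" | "i \<ge> int n" | "i \<in> {0<..<int n}" by force
  then show thesis
  proof cases
    case 1
    then show ?thesis using k[of i] assms(2) that(1) by auto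
  next
    case 2
    then show ?thesis using k1[of i] assms(2) that(3) by auto
  next
    case 3
    then show ?thesis using mono[of 0 i] mono[of i "int n"] k[of 0] k1[of "int n"] that(2) by auto
  qed
qed

lemma greville_mem:
  assumes "knot_sequence n k x" "k > 0" "j \<in> {- int k..int n - 1}"
  shows "greville k x j \<in> {0..1}"
proof -
  have *: "x i \<in> {0..1}" if "i \<in> {j+1..j + int k}" for i
  proof -
    have "i \<in> {- int k..int n + int k}" using assms(3) that by auto
    then show ?thesis by (rule knot_sequence_cases[OF assms(1)]) auto
  qed
  then have "(\<Sum>i=j+1..j + int k. x i) \<ge> 0" by (intro sum_nonneg) auto
  moreover have "(\<Sum>i=j+1..j + int k. x i) \<le> of_nat (card {j+1..j + int k}) * 1"
    using * by (intro sum_bounded_above) auto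
  ultimately show ?thesis using assms(2) by (simp add: greville_def)
qed

lemma count_list_map_le_1:
  assumes "distinct js" "\<And>i i'. i \<in> set js \<Longrightarrow> i' \<in> set js \<Longrightarrow> f i = t \<Longrightarrow> f i' = t \<Longrightarrow> i = i'"
  shows "count_list (map f js) t \<le> 1"
  using assms
proof (induction js)
  case (Cons a js)
  show ?case
  proof (cases "f a = t")
    case True
    have "f i \<noteq> t" if "i \<in> set js" for i
      using Cons.prems(1) Cons.prems(2)[of a i] True that by auto
    then have "t \<notin> set (map f js)" by auto
    then have "count_list (map f js) t = 0" by (rule count_notin)
    then show ?thesis using True by simp
  next
    case False
    then show ?thesis using Cons by simp
  qed
qed simp

lemma bspline_pre_continuous:
  assumes x: "knot_sequence n k x" and k: "k > 0" and j: "j \<in> {- int k..int n - 1}"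
  obtains H where "continuous_on UNIV H" "\<And>y. y \<in> {0<..<1} \<Longrightarrow> bspline_pre k x j y = H y"
proof -
  define ts where "ts = map x [j..j + int k + 1]"
  have "ts \<noteq> []" by (simp add: ts_def)
  then obtain W where W: "\<And>g. divided_difference ts g =
      (\<Sum>t\<in>set ts. \<Sum>i<count_list ts t. (deriv ^^ i) g t * W t i)"
    using divided_difference_linear by blast
  have range: "t = 0 \<or> t = 1 \<or> (t \<in> {0<..<1} \<and> count_list ts t \<le> 1)" if t: "t \<in> set ts" for t
  proof -
    obtain l where l: "l \<in> {j..j + int k + 1}" "t = x l" using t by (auto simp: ts_def)
    have mem: "i \<in> {- int k..int n + int k}" if "i \<in> {j..j + int k + 1}" for i
      using that j by auto
    have "count_list ts t \<le> 1" if t01: "0 < t" "t < 1"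
      unfolding ts_def
    proof (rule count_list_map_le_1)
      fix i i' assume i: "i \<in> set [j..j + int k + 1]" "i' \<in> set [j..j + int k + 1]" "x i = t" "x i' = t"
      have in01: "a \<in> {0<..<int n}" if "a \<in> {j..j + int k + 1}" "x a = t" for a
        using knot_sequence_cases[OF x mem[OF that(1)]] that t01 by force
      have "inj_on x {0..int n}"
        using x by (auto simp: knot_sequence_def intro: strict_mono_on_imp_inj_on)
      then show "i = i'" using in01[of i] in01[of i'] i by (auto simp: inj_on_def)
    qed simp
    then show ?thesis using l(2)
      by (cases rule: knot_sequence_cases[OF x mem[OF l(1)]]) auto
  qed
  define h where "h = (\<lambda>t i y. if t = 0 then 0
      else if t = 1 then (\<Prod>l<i. real k - real l) * (1 - y) ^ (k - i)
      else (max 0 (t - y)) ^ k)"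
  have h: "(deriv ^^ i) (\<lambda>t. trunc_power k (t - y)) t = h t i y"
    if "t \<in> set ts" "i < count_list ts t" "y \<in> {0<..<1}" for t i y
  proof -
    consider "t = 0" | "t = 1" | "t \<in> {0<..<1}" "i = 0" using range[OF \<open>t \<in> set ts\<close>] \<open>i < count_list ts t\<close> by force
    then show ?thesis
    proof cases
      case 3
      then show ?thesis using k by (auto simp: h_def trunc_power_def max_def)
    qed (use \<open>y \<in> {0<..<1}\<close> in \<open>auto simp: h_def higher_deriv_trunc_power\<close>)
  qed
  have conth: "continuous_on UNIV (h t i)" for t i
    by (cases "t = 0"; cases "t = 1") (auto simp: h_def intro!: continuous_intros)
  define H where "H = (\<lambda>y. (x (j + int k + 1) - x j) *
      (\<Sum>t\<in>set ts. \<Sum>i<count_list ts t. h t i y * W t i))"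
  show thesis
  proof
    show "continuous_on UNIV H"
      unfolding H_def by (intro continuous_intros conth)
    show "bspline_pre k x j y = H y" if "y \<in> {0<..<1}" for y
      using that h unfolding bspline_pre_def H_def ts_def[symmetric] W
      by (intro arg_cong2[where f = "(*)"] refl sum.cong) auto
  qed
qed

lemma schoenberg_fun_representation:
  assumes x: "knot_sequence n k x" and n: "n > 0" and k: "k > 0"
  obtains H where "\<And>j. j \<in> {- int k..int n - 1} \<Longrightarrow> continuous_on UNIV (H j)"
    "\<And>f y. y \<in> {0..1} \<Longrightarrow> schoenberg_fun n k x f y =
      (\<Sum>j=- int k..int n - 1. apply_bcontfun f (unit_of_real (greville k x j)) * H j y)"
proof -
  have "\<forall>j\<in>{- int k..int n - 1}. \<exists>H. continuous_on UNIV H \<and>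
      (\<forall>y\<in>{0<..<1}. bspline_pre k x j y = H y)"
    using bspline_pre_continuous[OF x k] by metis
  then obtain H where cont: "\<And>j. j \<in> {- int k..int n - 1} \<Longrightarrow> continuous_on UNIV (H j)"
    and H: "\<And>j y. j \<in> {- int k..int n - 1} \<Longrightarrow> y \<in> {0<..<1} \<Longrightarrow> bspline_pre k x j y = H j y"
    by metis
  have lim: "(H j \<longlongrightarrow> H j a) (at a within S)" if "j \<in> {- int k..int n - 1}" for j a S
    using cont[OF that] by (metis UNIV_I continuous_on_def subset_UNIV tendsto_within_subset)
  have b: "bspline k x j y = H j y" if j: "j \<in> {- int k..int n - 1}" and y: "y \<in> {0..<1}" for j y
  proof (cases "y = 0")
    case True
    have "eventually (\<lambda>y. y \<in> {0<..<1}) (at_right (0::real))"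
      by (rule eventually_at_right_real) simp
    then have "eventually (\<lambda>y. H j y = bspline_pre k x j y) (at_right 0)"
      by eventually_elim (use H[OF j] in auto)
    with lim[OF j] have "(bspline_pre k x j \<longlongrightarrow> H j 0) (at_right 0)"
      by (rule Lim_transform_eventually)
    then have "Lim (at_right 0) (bspline_pre k x j) = H j 0"
      by (intro tendsto_Lim) auto
    then show ?thesis using True by (simp add: bspline_def)
  next
    case False
    then show ?thesis using H[OF j, of y] y by (simp add: bspline_def)
  qed
  define R where "R = (\<lambda>f y. \<Sum>j=- int k..int n - 1. apply_bcontfun f (unit_of_real (greville k x j)) * H j y)"
  have s: "schoenberg_sum n k x f y = R f y" if "y \<in> {0..<1}" for f y
    unfolding schoenberg_sum_def R_def using b that by (intro sum.cong refl) auto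
  have "schoenberg_fun n k x f y = R f y" if "y \<in> {0..1}" for f y
  proof (cases "y < 1")
    case True
    then show ?thesis using that by (simp add: schoenberg_fun_def s)
  next
    case False
    have "eventually (\<lambda>y. y \<in> {0<..<1}) (at_left (1::real))"
      by (rule eventually_at_left_real) simp
    then have "eventually (\<lambda>y. R f y = schoenberg_sum n k x f y) (at_left 1)"
      by eventually_elim (use s in auto)
    moreover have "(R f \<longlongrightarrow> R f 1) (at_left 1)"
      unfolding R_def by (intro tendsto_intros lim) auto
    ultimately have "(schoenberg_sum n k x f \<longlongrightarrow> R f 1) (at_left 1)"
      using Lim_transform_eventually by blast
    then have "Lim (at_left 1) (schoenberg_sum n k x f) = R f 1"
      by (intro tendsto_Lim) auto
    then show ?thesis using that False by (simp add: schoenberg_fun_def)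
  qed
  with cont show thesis using that by (auto simp: R_def)
qed

lemma apply_schoenberg:
  assumes "knot_sequence n k x" "n > 0" "k > 0"
  shows "apply_bcontfun (schoenberg n k x f) t = schoenberg_fun n k x f (real_of_unit t)"
proof -
  obtain H where cont: "\<And>j. j \<in> {- int k..int n - 1} \<Longrightarrow> continuous_on UNIV (H j)"
    and H: "\<And>f y. y \<in> {0..1} \<Longrightarrow> schoenberg_fun n k x f y =
      (\<Sum>j=- int k..int n - 1. apply_bcontfun f (unit_of_real (greville k x j)) * H j y)"
    using schoenberg_fun_representation[OF assms] by metis
  have "continuous_on UNIV (\<lambda>t. H j (real_of_unit t))" if "j \<in> {- int k..int n - 1}" for j
    by (rule continuous_on_compose2[OF cont[OF that] continuous_on_real_of_unit]) auto
  then have "continuous_on UNIV (\<lambda>t. schoenberg_fun n k x f (real_of_unit t))"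
    unfolding H[OF real_of_unit] by (intro continuous_intros) auto
  then show ?thesis
    by (simp add: schoenberg_def Bcontfun_inverse bcontfun_unit_interval_iff)
qed

lemma bounded_linear_schoenberg:
  assumes "knot_sequence n k x" "n > 0" "k > 0"
  shows "bounded_linear (schoenberg n k x)"
proof -
  obtain H where cont: "\<And>j. j \<in> {- int k..int n - 1} \<Longrightarrow> continuous_on UNIV (H j)"
    and H: "\<And>f y. y \<in> {0..1} \<Longrightarrow> schoenberg_fun n k x f y =
      (\<Sum>j=- int k..int n - 1. apply_bcontfun f (unit_of_real (greville k x j)) * H j y)"
    using schoenberg_fun_representation[OF assms] by metis
  have app: "apply_bcontfun (schoenberg n k x f) t =
      (\<Sum>j=- int k..int n - 1. apply_bcontfun f (unit_of_real (greville k x j)) * H j (real_of_unit t))" for f t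
    by (simp only: apply_schoenberg[OF assms] H[OF real_of_unit])
  have "\<exists>B. \<forall>y\<in>{0..1}. \<bar>H j y\<bar> \<le> B" if "j \<in> {- int k..int n - 1}" for j
  proof -
    have "compact (H j ` {0..1})"
      using cont[OF that] by (intro compact_continuous_image) (auto intro: continuous_on_subset)
    from compact_imp_bounded[OF this] show ?thesis by (auto simp: bounded_iff)
  qed
  then obtain B where B: "\<And>j y. j \<in> {- int k..int n - 1} \<Longrightarrow> y \<in> {0..1} \<Longrightarrow> \<bar>H j y\<bar> \<le> B j"
    by metis
  show ?thesis
  proof (rule bounded_linear_intro)
    fix f g :: "unit_interval \<Rightarrow>\<^sub>C real" and r :: real
    show "schoenberg n k x (f + g) = schoenberg n k x f + schoenberg n k x g"
      by (rule bcontfun_eqI) (simp add: app sum.distrib ring_distribs)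
    show "schoenberg n k x (r *\<^sub>R f) = r *\<^sub>R schoenberg n k x f"
      by (rule bcontfun_eqI) (simp add: app sum_distrib_left mult.assoc)
    show "norm (schoenberg n k x f) \<le> norm f * (\<Sum>j=- int k..int n - 1. B j)"
    proof (rule norm_bound)
      fix t
      have "norm (apply_bcontfun (schoenberg n k x f) t) \<le>
          (\<Sum>j=- int k..int n - 1. norm f * B j)"
        unfolding app
      proof (rule sum_norm_le)
        fix j assume "j \<in> {- int k..int n - 1}"
        then show "norm (apply_bcontfun f (unit_of_real (greville k x j)) * H j (real_of_unit t)) \<le> norm f * B j"
          unfolding norm_mult
          using norm_bounded[of f] B[OF _ real_of_unit] by (intro mult_mono) auto
      qed
      then show "norm (apply_bcontfun (schoenberg n k x f) t) \<le> norm f * (\<Sum>j=- int k..int n - 1. B j)"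
        by (simp add: sum_distrib_left)
    qed
  qed
qed

end

theory Submission
  imports Defs
begin

text \<open>The Schoenberg operator has finite rank. Being of finite rank, it is not injective
  (some nonzero function vanishes at all Greville nodes), and for a nonzero \<open>l\<close> injectivity of
  \<open>S - l\<close> implies surjectivity on the span of the B-splines, which yields an explicit bounded
  inverse. An eigenvector for \<open>l \<noteq> 0\<close> restricts on the Greville nodes to an eigenvector of the
  collocation matrix \<open>N\<^sub>j(\<xi>\<^sub>i)\<close>. This matrix is nonnegative with row sums 1 and has a positive
  diagonal, so by Gershgorin's theorem the only eigenvalue on the unit circle is 1.\<close>

section \<open>Finite-rank operators\<close>

context
  includes bcontfun.lifting
begin

lemma apply_bcontfun_Re [simp]: "apply_bcontfun (bcontfun_Re f) t = Re (apply_bcontfun f t)"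
  by transfer simp

lemma apply_bcontfun_Im [simp]: "apply_bcontfun (bcontfun_Im f) t = Im (apply_bcontfun f t)"
  by transfer simp

lemma apply_bcontfun_Complex [simp]:
  "apply_bcontfun (bcontfun_Complex f g) t = Complex (apply_bcontfun f t) (apply_bcontfun g t)"
  by transfer simp

lemma apply_bcontfun_scaleC [simp]:
  "apply_bcontfun (bcontfun_scaleC c f) t = c * apply_bcontfun f t"
  by transfer simp

end

lemma apply_bcontfun_sum [simp]:
  "apply_bcontfun (\<Sum>j\<in>J. f j) t = (\<Sum>j\<in>J. apply_bcontfun (f j) t)"
  by (induction J rule: infinite_finite_induct) auto

lemma bounded_linear_bcontfun_scaleC: "bounded_linear (bcontfun_scaleC c)"
proof (rule bounded_linear_intro)
  fix f :: "'a::topological_space \<Rightarrow>\<^sub>C complex"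
  show "norm (bcontfun_scaleC c f) \<le> norm f * cmod c"
    by (rule norm_bound) (simp add: norm_mult mult.commute mult_left_mono norm_bounded)
qed (auto intro!: bcontfun_eqI simp: algebra_simps)

text \<open>The rank-one summands of the explicit inverse constructed below have this form.\<close>

lemma bounded_linear_scaleC_apply:
  "bounded_linear (\<lambda>f :: 'a::topological_space \<Rightarrow>\<^sub>C complex. bcontfun_scaleC (apply_bcontfun f q) w)"
proof (rule bounded_linear_intro)
  fix f :: "'a \<Rightarrow>\<^sub>C complex"
  show "norm (bcontfun_scaleC (apply_bcontfun f q) w) \<le> norm f * norm w"
    by (rule norm_bound) (simp add: norm_mult mult_mono norm_bounded)
qed (auto intro!: bcontfun_eqI simp: algebra_simps)

lemma invertible_op_imp_inj: "invertible_op A \<Longrightarrow> inj A"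
  unfolding invertible_op_def by (metis inj_on_id inj_on_imageI2)

text \<open>Injectivity carries a basis \<open>B\<close> of the invariant finite-dimensional span to
  an independent set of the same size inside it. A vector outside the span of that image could be
  adjoined, giving more independent vectors than \<open>B\<close> allows. The ambient space may be
  infinite-dimensional.\<close>

lemma inj_linear_span_surj:
  fixes A :: "'v::real_vector \<Rightarrow> 'v"
  assumes "linear A" "inj A" "finite G" "A ` span G \<subseteq> span G"
  shows "span G \<subseteq> A ` span G"
proof
  fix v assume v: "v \<in> span G"
  obtain B where B: "B \<subseteq> G" "independent B" "G \<subseteq> span B"
    using maximal_independent_subset[of G] by metis
  have span: "span G = span B"
    using span_mono[OF B(1)] span_minimal[OF B(3) subspace_span] by (rule subset_antisym[rotated])
  have fin: "finite B" using B(1) assms(3) by (rule finite_subset)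
  have ind: "independent (A ` B)"
    using assms(1,2) B(2) by (simp add: linear_independent_injective_image inj_on_subset)
  have card: "card (A ` B) = card B"
    using assms(2) by (simp add: card_image inj_on_subset)
  have sub: "A ` B \<subseteq> span B"
    using image_mono[OF span_superset[of B], of A] assms(4) unfolding span by (rule order_trans)
  have "v \<in> span (A ` B)"
  proof (rule ccontr)
    assume nv: "v \<notin> span (A ` B)"
    then have "independent (insert v (A ` B))"
      using ind by (simp add: independent_insert)
    moreover have "insert v (A ` B) \<subseteq> span B" using sub v span by simp
    ultimately have "card (insert v (A ` B)) \<le> card B"
      using independent_span_bound[OF fin, of "insert v (A ` B)"] by simp
    moreover have "v \<notin> A ` B" using nv span_superset[of "A ` B"] by (rule contra_subsetD[rotated])
    ultimately show False using card fin by simp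
  qed
  then show "v \<in> A ` span G"
    using linear_span_image[OF assms(1), of B] span by simp
qed

text \<open>The coefficient functionals are point evaluations, so an eigenvector can be restricted
  to the nodes \<open>p j\<close> and compared with the matrix of the values
  \<open>h j (p i)\<close>.\<close>

locale finite_rank_op =
  fixes T :: "('a::topological_space \<Rightarrow>\<^sub>C real) \<Rightarrow> ('a \<Rightarrow>\<^sub>C real)"
    and J :: "'i set" and p :: "'i \<Rightarrow> 'a" and h :: "'i \<Rightarrow> ('a \<Rightarrow>\<^sub>C real)"
  assumes finite_index: "finite J"
    and op_eq: "T f = (\<Sum>j\<in>J. apply_bcontfun f (p j) *\<^sub>R h j)"
begin

lemma apply_shifted_op:
  "apply_bcontfun (shifted_op T l f) t =
    (\<Sum>j\<in>J. apply_bcontfun f (p j) * complex_of_real (apply_bcontfun (h j) t)) - l * apply_bcontfun f t"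
  by (simp add: shifted_op_def complexify_def op_eq complex_eq_iff)

lemma linear_shifted_op: "linear (shifted_op T l)"
  by (intro linearI bcontfun_eqI)
    (simp_all add: apply_shifted_op algebra_simps sum.distrib scaleR_sum_right)

lemma shifted_op_zero [simp]: "shifted_op T l 0 = 0"
  using linear_shifted_op by (rule linear_0)

lemma eigenvectorE:
  assumes "l \<in> point_spectrum T"
  obtains f where "f \<noteq> 0" "\<And>t. (\<Sum>j\<in>J. apply_bcontfun f (p j) * complex_of_real (apply_bcontfun (h j) t))
      = l * apply_bcontfun f t"
proof -
  have "\<not> inj (shifted_op T l)" using assms by (simp add: point_spectrum_def)
  then obtain f where f: "f \<noteq> 0" "shifted_op T l f = 0"
    using linear_injective_0[OF linear_shifted_op[of l]] by blast
  show thesis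
  proof (rule that[OF f(1)])
    fix t
    have "apply_bcontfun (shifted_op T l f) t = 0" using f(2) by simp
    then show "(\<Sum>j\<in>J. apply_bcontfun f (p j) * complex_of_real (apply_bcontfun (h j) t))
      = l * apply_bcontfun f t"
      unfolding apply_shifted_op by simp
  qed
qed

text \<open>Write \<open>c j\<close> for the complexified \<open>h j\<close>. On their complex span
  the injective \<open>?A\<close> is onto, so \<open>?A (w j) = c j / l\<close> can be solved; then
  \<open>g\<close> is mapped by the inverse to the sum of \<open>g (p j) * w j\<close> minus
  \<open>g / l\<close>.\<close>

lemma inj_shifted_op_imp_invertible:
  assumes inj: "inj (shifted_op T l)" and l: "l \<noteq> 0"
  shows "invertible_op (shifted_op T l)"
proof -
  let ?A = "shifted_op T l"
  define c where "c = (\<lambda>j. bcontfun_Complex (h j) 0)"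
  \<comment> \<open>\<open>span\<close> is taken over the reals; adjoining the multiples by
    \<open>\<i>\<close> makes it closed under complex scalars.\<close>
  define G where "G = c ` J \<union> (\<lambda>j. bcontfun_scaleC \<i> (c j)) ` J"
  have scale: "bcontfun_scaleC z (c j) \<in> span G" if "j \<in> J" for z j
  proof -
    have "bcontfun_scaleC z (c j) = Re z *\<^sub>R c j + Im z *\<^sub>R bcontfun_scaleC \<i> (c j)"
      by (rule bcontfun_eqI) (simp add: complex_eq_iff)
    then show ?thesis
      using that by (simp add: G_def span_add span_scale span_base)
  qed
  have closed: "bcontfun_scaleC z v \<in> span G" if "v \<in> span G" for z v
  proof -
    have "linear (bcontfun_scaleC z :: ('a \<Rightarrow>\<^sub>C complex) \<Rightarrow> _)"
      using bounded_linear_bcontfun_scaleC bounded_linear.linear by blast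
    then have "bcontfun_scaleC z ` span G = span (bcontfun_scaleC z ` G)"
      by (rule linear_span_image[symmetric])
    moreover have "bcontfun_scaleC z (bcontfun_scaleC \<i> (c j)) = bcontfun_scaleC (z * \<i>) (c j)" for j
      by (rule bcontfun_eqI) simp
    then have "span (bcontfun_scaleC z ` G) \<subseteq> span G"
      using scale by (intro span_minimal) (auto simp: G_def)
    ultimately show ?thesis using that by blast
  qed
  have shifted: "?A v = (\<Sum>j\<in>J. bcontfun_scaleC (apply_bcontfun v (p j)) (c j)) - bcontfun_scaleC l v" for v
    by (rule bcontfun_eqI) (simp add: apply_shifted_op c_def complex_of_real_def)
  have "?A ` span G \<subseteq> span G"
    unfolding shifted by (auto intro!: span_diff span_sum intro: scale closed)
  then have surj: "span G \<subseteq> ?A ` span G"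
    using linear_shifted_op inj finite_index by (intro inj_linear_span_surj) (auto simp: G_def)
  have "\<forall>j\<in>J. \<exists>w. ?A w = bcontfun_scaleC (1 / l) (c j)"
    using scale surj by (metis imageE subsetD)
  then obtain w where w: "\<And>j. j \<in> J \<Longrightarrow> ?A (w j) = bcontfun_scaleC (1 / l) (c j)"
    by metis
  define R where "R = (\<lambda>g. (\<Sum>j\<in>J. bcontfun_scaleC (apply_bcontfun g (p j)) (w j)) - bcontfun_scaleC (1 / l) g)"
  have "bounded_linear R"
    unfolding R_def
    by (intro bounded_linear_sub bounded_linear_sum bounded_linear_scaleC_apply bounded_linear_bcontfun_scaleC)
  moreover have "R (bcontfun_scaleC z f) = bcontfun_scaleC z (R f)" for z f
    by (rule bcontfun_eqI) (simp add: R_def algebra_simps sum_distrib_left)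
  ultimately have R: "bounded_clinear R" by (simp add: bounded_clinear_def)
  have A_scale: "?A (bcontfun_scaleC z f) = bcontfun_scaleC z (?A f)" for z f
    by (rule bcontfun_eqI) (simp add: apply_shifted_op algebra_simps sum_distrib_left)
  have AR: "?A (R g) = g" for g
  proof -
    have "?A (R g) = (\<Sum>j\<in>J. bcontfun_scaleC (apply_bcontfun g (p j)) (?A (w j))) - bcontfun_scaleC (1 / l) (?A g)"
      unfolding R_def by (simp add: linear_diff[OF linear_shifted_op] linear_sum[OF linear_shifted_op] A_scale)
    also have "\<dots> = (\<Sum>j\<in>J. bcontfun_scaleC (apply_bcontfun g (p j)) (bcontfun_scaleC (1 / l) (c j)))
        - bcontfun_scaleC (1 / l) (?A g)"
      using w by simp
    \<comment> \<open>The finite-rank part of \<open>?A g / l\<close> cancels the first sum, and the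
      shift contributes \<open>g\<close>.\<close>
    also have "\<dots> = g"
      by (rule bcontfun_eqI) (use l in \<open>simp add: shifted algebra_simps sum_divide_distrib\<close>)
    finally show ?thesis .
  qed
  \<comment> \<open>A right inverse of an injective map is also a left inverse.\<close>
  moreover have "R (?A f) = f" for f
    using inj AR by (metis injD)
  ultimately show ?thesis
    unfolding invertible_op_def using R by (auto simp: fun_eq_iff)
qed

text \<open>The function \<open>g\<close> is an eigenvector for 0, so 0 is in the point spectrum;
  every other spectral value is covered by the finite-rank inverse.\<close>

lemma spectrum_eq_point_spectrum:
  fixes g :: "'a \<Rightarrow>\<^sub>C real"
  assumes "g \<noteq> 0" "\<And>j. j \<in> J \<Longrightarrow> apply_bcontfun g (p j) = 0"
  shows "spectrum T = point_spectrum T"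
proof (intro equalityI subsetI)
  fix l assume l: "l \<in> spectrum T"
  show "l \<in> point_spectrum T"
  proof (cases "l = 0")
    case True
    define f where "f = bcontfun_Complex g 0"
    have "shifted_op T 0 f = 0"
      by (rule bcontfun_eqI) (simp add: apply_shifted_op f_def assms(2) complex_eq_iff)
    moreover obtain t where "apply_bcontfun g t \<noteq> 0"
      using assms(1) bcontfun_eqI[of g 0] by auto
    then have "apply_bcontfun f t \<noteq> 0" by (simp add: f_def complex_eq_iff)
    then have "f \<noteq> 0" by auto
    ultimately have "\<not> inj (shifted_op T 0)"
      by (metis injD shifted_op_zero)
    then show ?thesis using True by (simp add: point_spectrum_def)
  next
    case False
    then show ?thesis using l inj_shifted_op_imp_invertible by (auto simp: spectrum_def point_spectrum_def)
  qed
next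
  fix l assume "l \<in> point_spectrum T"
  then show "l \<in> spectrum T" using invertible_op_imp_inj by (auto simp: spectrum_def point_spectrum_def)
qed

text \<open>Gershgorin's theorem: each eigenvalue lies in one of the discs about a diagonal entry
  \<open>h i (p i)\<close> of radius \<open>1 - h i (p i)\<close>, which meets the unit circle only at 1.\<close>

lemma point_spectrum_stochastic:
  assumes nonneg: "\<And>i j. i \<in> J \<Longrightarrow> j \<in> J \<Longrightarrow> apply_bcontfun (h j) (p i) \<ge> 0"
    and row: "\<And>i. i \<in> J \<Longrightarrow> (\<Sum>j\<in>J. apply_bcontfun (h j) (p i)) = 1"
    and diag: "\<And>i. i \<in> J \<Longrightarrow> apply_bcontfun (h i) (p i) > 0"
  shows "point_spectrum T \<subseteq> {l. cmod l < 1} \<union> {1}"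
proof
  fix l assume "l \<in> point_spectrum T"
  then obtain f where f: "f \<noteq> 0"
    and eig: "\<And>t. (\<Sum>j\<in>J. apply_bcontfun f (p j) * complex_of_real (apply_bcontfun (h j) t)) = l * apply_bcontfun f t"
    by (rule eigenvectorE) blast
  show "l \<in> {l. cmod l < 1} \<union> {1}"
  proof (cases "\<forall>j\<in>J. apply_bcontfun f (p j) = 0")
    case True
    \<comment> \<open>The sum in the eigenvalue equation vanishes at every \<open>t\<close>, so
      \<open>f \<noteq> 0\<close> forces \<open>l = 0\<close>.\<close>
    with eig have "l * apply_bcontfun f t = 0" for t by (metis (no_types, lifting) mult_zero_left sum.neutral)
    moreover obtain t where "apply_bcontfun f t \<noteq> 0"
      using f bcontfun_eqI[of f 0] by auto
    ultimately have "l = 0" by (metis mult_eq_0_iff)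
    then show ?thesis by simp
  next
    case False
    define c where "c = (\<lambda>j. apply_bcontfun f (p j))"
    have "J \<noteq> {}" using False by auto
    then have "Max ((\<lambda>j. cmod (c j)) ` J) \<in> (\<lambda>j. cmod (c j)) ` J"
      using finite_index by (intro Max_in) auto
    \<comment> \<open>Gershgorin's choice of row: the index of an entry of largest modulus, so that
      all other entries are bounded by it.\<close>
    then obtain i where i: "i \<in> J" and "cmod (c i) = Max ((\<lambda>j. cmod (c j)) ` J)" by auto
    then have max: "cmod (c j) \<le> cmod (c i)" if "j \<in> J" for j
      using that finite_index by simp
    have ci: "cmod (c i) > 0"
      using False max by (force simp: c_def)
    define a where "a = (\<lambda>j. apply_bcontfun (h j) (p i))"
    have "l * c i = c i * a i + (\<Sum>j\<in>J - {i}. c j * complex_of_real (a j))"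
      using eig[of "p i"] by (simp only: sum.remove[OF finite_index i] c_def a_def)
    then have "(l - a i) * c i = (\<Sum>j\<in>J - {i}. c j * complex_of_real (a j))"
      by (simp add: algebra_simps)
    then have "cmod (l - a i) * cmod (c i) = cmod (\<Sum>j\<in>J - {i}. c j * complex_of_real (a j))"
      by (metis norm_mult)
    also have "\<dots> \<le> (\<Sum>j\<in>J - {i}. cmod (c i) * a j)"
      using max nonneg i by (intro sum_norm_le) (auto simp: norm_mult a_def mult_right_mono)
    also have "\<dots> = (1 - a i) * cmod (c i)"
      using row[OF i] sum.remove[OF finite_index i, of a] by (simp add: a_def sum_distrib_left[symmetric])
    finally have disc: "cmod (l - a i) \<le> 1 - a i" using ci by simp
    have ai: "a i > 0" using diag[OF i] by (simp add: a_def)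
    \<comment> \<open>Squaring the disc inequality gives a bound on \<open>cmod l\<close> that is
      strict unless \<open>Re l = 1\<close>, because \<open>a i > 0\<close>; at
      \<open>Re l = 1\<close> it forces \<open>Im l = 0\<close>.\<close>
    have "(Re l - a i)\<^sup>2 + (Im l)\<^sup>2 \<le> (1 - a i)\<^sup>2"
      using power_mono[OF disc norm_ge_zero, of 2] by (simp add: cmod_power2)
    then have eq: "(cmod l)\<^sup>2 \<le> 1 - 2 * a i * (1 - Re l)"
      unfolding cmod_power2 by (simp add: power2_eq_square algebra_simps)
    have "Re (l - a i) \<le> 1 - a i" using disc complex_Re_le_cmod order_trans by blast
    then consider "Re l < 1" | "Re l = 1" by force
    then show ?thesis
    proof cases
      case 1
      then have "2 * a i * (1 - Re l) > 0" using ai by simp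
      then have "(cmod l)\<^sup>2 < 1\<^sup>2" using eq by simp
      then have "cmod l < 1" using power2_less_imp_less by fastforce
      then show ?thesis by simp
    next
      case 2
      then have "Im l = 0" using eq by (simp add: cmod_power2)
      then show ?thesis using 2 by (simp add: complex_eq_iff)
    qed
  qed
qed

end

section \<open>Divided differences of truncated powers\<close>

text \<open>The numbers \<open>D i t\<close> stand in for derivatives of a function. This makes the
  rules below purely algebraic, valid also at repeated nodes where a truncated power is not
  differentiable.\<close>

definition data_dd :: "real list \<Rightarrow> (nat \<Rightarrow> real \<Rightarrow> real) \<Rightarrow> real" where
  "data_dd ts D = coeff (THE p. interp_data ts D p) (length ts - 1)"

lemma data_dd_eq:
  assumes "interp_data ts D p"
  shows "data_dd ts D = coeff p (length ts - 1)"
proof -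
  have "(THE p. interp_data ts D p) = p"
    using assms interp_data_unique by blast
  then show ?thesis by (simp add: data_dd_def)
qed

lemma interp_data_cong:
  assumes "\<And>t i. t \<in> set ts \<Longrightarrow> i < count_list ts t \<Longrightarrow> D i t = E i t"
  shows "interp_data ts D = interp_data ts E"
  using assms by (auto simp: interp_data_def fun_eq_iff)

lemma data_dd_cong:
  assumes "\<And>t i. t \<in> set ts \<Longrightarrow> i < count_list ts t \<Longrightarrow> D i t = E i t"
  shows "data_dd ts D = data_dd ts E"
  using interp_data_cong[OF assms] by (simp add: data_dd_def)

lemma divided_difference_eq_data_dd: "divided_difference ts g = data_dd ts (\<lambda>i. (deriv ^^ i) g)"
  by (simp add: divided_difference_def data_dd_def interp_data_def hermite_interpolates_def)

lemma interp_dataD: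
  "interp_data ts D p \<Longrightarrow> i < count_list ts t \<Longrightarrow> poly ((pderiv ^^ i) p) t = D i t"
  unfolding interp_data_def by (metis count_notin not_less_zero)

lemma interp_data_coeff_0: "interp_data ts D p \<Longrightarrow> length ts \<le> m \<Longrightarrow> coeff p m = 0"
  by (simp add: interp_data_def coeff_eq_0)

text \<open>Leibniz' rule: derivatives of the linear factor beyond the first vanish, leaving two
  terms. For \<open>i = 0\<close> the truncated index \<open>i - 1\<close> is harmless, being
  multiplied by \<open>real i\<close>.\<close>

lemma higher_pderiv_linear_mult:
  fixes p :: "real poly"
  shows "poly ((pderiv ^^ i) ([:c, d:] * p)) t =
    (c + d * t) * poly ((pderiv ^^ i) p) t + real i * d * poly ((pderiv ^^ (i - 1)) p) t"
proof -
  have step: "pderiv ([:c, d:] * q) = [:c, d:] * pderiv q + smult d q" for q :: "real poly"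
    unfolding pderiv_mult by (simp add: pderiv_pCons)
  have "(pderiv ^^ i) ([:c, d:] * p) = [:c, d:] * (pderiv ^^ i) p + smult (real i * d) ((pderiv ^^ (i - 1)) p)"
  proof (induction i)
    case (Suc i)
    have "pderiv (smult (real i * d) ((pderiv ^^ (i - 1)) p)) = smult (real i * d) ((pderiv ^^ i) p)"
      by (cases i) (simp_all add: pderiv_smult)
    moreover have "(pderiv ^^ Suc i) ([:c, d:] * p) =
        pderiv ([:c, d:] * (pderiv ^^ i) p) + pderiv (smult (real i * d) ((pderiv ^^ (i - 1)) p))"
      by (simp only: funpow.simps o_apply Suc.IH pderiv_add)
    ultimately show ?case
      unfolding step by (simp del: mult_pCons_left add: algebra_simps smult_add_left)
  qed simp
  then show ?thesis by (simp del: mult_pCons_left)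
qed

text \<open>Neville's formula for Hermite data: the weights \<open>t - a\<close> and
  \<open>b - t\<close> add up to \<open>b - a\<close>.\<close>

lemma interp_data_Cons_snoc:
  assumes q: "interp_data (ts @ [b]) D q" and r: "interp_data (a # ts) D r" and ab: "a \<noteq> b"
  shows "interp_data (a # ts @ [b]) D (smult (1 / (b - a)) ([:- a, 1:] * q + [:b, - 1:] * r))"
    (is "interp_data _ _ (smult _ ?s)")
proof -
  have "degree q \<le> length ts" "degree r \<le> length ts"
    using q r by (auto simp: interp_data_def)
  then have "degree ?s \<le> Suc (length ts)"
    by (intro degree_add_le order_trans[OF degree_mult_le]) auto
  moreover have "poly ((pderiv ^^ i) (smult (1 / (b - a)) ?s)) t = D i t"
    if i: "i < count_list (a # ts @ [b]) t" for i t
  proof -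
    have eq: "poly ((pderiv ^^ i) ?s) t =
        (t - a) * poly ((pderiv ^^ i) q) t + (b - t) * poly ((pderiv ^^ i) r) t +
        real i * (poly ((pderiv ^^ (i - 1)) q) t - poly ((pderiv ^^ (i - 1)) r) t)"
      by (simp only: higher_pderiv_add poly_add higher_pderiv_linear_mult) (simp add: algebra_simps)
    \<comment> \<open>The extra Leibniz term cancels: since \<open>a \<noteq> b\<close>, passing to
      either shorter list lowers the multiplicity of \<open>t\<close> by at most one, so both
      polynomials still match the datum of order \<open>i - 1\<close>.\<close>
    have q_r: "real i * (poly ((pderiv ^^ (i - 1)) q) t - poly ((pderiv ^^ (i - 1)) r) t) = 0"
    proof (cases "i = 0")
      case False
      then have "i - 1 < count_list (ts @ [b]) t" "i - 1 < count_list (a # ts) t"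
        using i ab by (auto split: if_splits)
      then show ?thesis using interp_dataD[OF q] interp_dataD[OF r] by simp
    qed simp
    \<comment> \<open>Only at \<open>t = a\<close> can \<open>q\<close> miss the datum of order
      \<open>i\<close>, and there the weight is 0; likewise for \<open>r\<close> at
      \<open>b\<close>.\<close>
    have q_D: "(t - a) * poly ((pderiv ^^ i) q) t = (t - a) * D i t"
      using i interp_dataD[OF q, of i t] by (cases "t = a") auto
    have r_D: "(b - t) * poly ((pderiv ^^ i) r) t = (b - t) * D i t"
      using i interp_dataD[OF r, of i t] by (cases "t = b") (auto split: if_splits)
    have "poly ((pderiv ^^ i) ?s) t = (b - a) * D i t"
      unfolding eq q_r q_D r_D by (simp add: algebra_simps)
    then show ?thesis using ab by (simp only: higher_pderiv_smult poly_smult) simp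
  qed
  ultimately show ?thesis
    by (auto simp: interp_data_def simp del: mult_pCons_left intro!: le_less_trans[OF degree_smult_le])
qed

lemma interp_data_dd_exists:
  assumes "ts \<noteq> []"
  obtains p where "interp_data ts D p" "data_dd ts D = coeff p (length ts - 1)"
  using interp_data_exists[OF assms] data_dd_eq by blast

text \<open>Comparison of the top coefficients in Neville's formula.\<close>

lemma data_dd_recurrence:
  assumes "a \<noteq> b"
  shows "(b - a) * data_dd (a # ts @ [b]) D = data_dd (ts @ [b]) D - data_dd (a # ts) D"
proof -
  obtain q where q: "interp_data (ts @ [b]) D q" "data_dd (ts @ [b]) D = coeff q (length ts)"
    using interp_data_dd_exists[of "ts @ [b]"] by auto
  obtain r where r: "interp_data (a # ts) D r" "data_dd (a # ts) D = coeff r (length ts)"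
    using interp_data_dd_exists[of "a # ts"] by auto
  show ?thesis
    using data_dd_eq[OF interp_data_Cons_snoc[OF q(1) r(1) assms]] assms
      interp_data_coeff_0[OF q(1), of "Suc (length ts)"] interp_data_coeff_0[OF r(1), of "Suc (length ts)"]
    by (simp add: q(2) r(2))
qed

text \<open>The data on the left are those of the product of a function with data \<open>D\<close> and \<open>t - y\<close>;
  this is Leibniz' rule for divided differences in the only case needed.\<close>

lemma data_dd_linear_mult:
  assumes "ts \<noteq> []"
  shows "data_dd (a # ts) (\<lambda>i t. (t - y) * D i t + real i * D (i - 1) t) =
    (a - y) * data_dd (a # ts) D + data_dd ts D"
proof -
  obtain m where m: "length ts = Suc m" using assms by (cases ts) auto
  obtain p where p: "interp_data (a # ts) D p" "data_dd (a # ts) D = coeff p (length ts)"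
    using interp_data_dd_exists[of "a # ts"] by auto
  obtain r where r: "interp_data ts D r" "data_dd ts D = coeff r m"
    using interp_data_dd_exists[OF assms] m by (metis diff_Suc_1)
  \<comment> \<open>Split \<open>t - y\<close> as \<open>(t - a) + (a - y)\<close>. In the first
    part the factor \<open>t - a\<close> accounts for the additional condition at \<open>a\<close>,
    so the interpolant on the shorter list suffices.\<close>
  let ?s = "[:- a, 1:] * r + smult (a - y) p"
  have "degree ([:- a, 1:] * r) \<le> Suc m"
    using r(1) m by (intro order_trans[OF degree_mult_le]) (auto simp: interp_data_def)
  moreover have "degree (smult (a - y) p) \<le> Suc m"
    using p(1) m by (intro order_trans[OF degree_smult_le]) (auto simp: interp_data_def)
  ultimately have "degree ?s \<le> Suc m" by (rule degree_add_le)
  moreover have "poly ((pderiv ^^ i) ?s) t = (t - y) * D i t + real i * D (i - 1) t"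
    if i: "i < count_list (a # ts) t" for i t
  proof -
    have eq: "poly ((pderiv ^^ i) ?s) t = (t - a) * poly ((pderiv ^^ i) r) t +
        (a - y) * poly ((pderiv ^^ i) p) t + real i * poly ((pderiv ^^ (i - 1)) r) t"
      by (simp only: higher_pderiv_add higher_pderiv_smult poly_add poly_smult higher_pderiv_linear_mult)
        (simp add: algebra_simps)
    have "real i * poly ((pderiv ^^ (i - 1)) r) t = real i * D (i - 1) t"
    proof (cases "i = 0")
      case False
      then have "i - 1 < count_list ts t" using i by (auto split: if_splits)
      then show ?thesis using interp_dataD[OF r(1)] by simp
    qed simp
    moreover have "(t - a) * poly ((pderiv ^^ i) r) t = (t - a) * D i t"
      using i interp_dataD[OF r(1), of i t] by (cases "t = a") auto
    ultimately show ?thesis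
      unfolding eq using interp_dataD[OF p(1) i] by (simp add: algebra_simps)
  qed
  ultimately have "interp_data (a # ts) (\<lambda>i t. (t - y) * D i t + real i * D (i - 1) t) ?s"
    using m by (auto simp: interp_data_def simp del: mult_pCons_left)
  from data_dd_eq[OF this] show ?thesis
    using interp_data_coeff_0[OF r(1), of "Suc m"] m by (simp add: p(2) r(2))
qed

text \<open>Derivatives of the truncated power in \<open>t\<close>, with the left-hand value 0 at
  \<open>t = y\<close>. This convention makes the recurrences hold for every \<open>y\<close>, even
  when \<open>y\<close> is a multiple knot.\<close>

definition trunc_data :: "nat \<Rightarrow> real \<Rightarrow> nat \<Rightarrow> real \<Rightarrow> real" where
  "trunc_data k y i t = (if t > y then poly ((pderiv ^^ i) ([:- y, 1:] ^ k)) t else 0)"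

text \<open>Brings the data of the next degree into the product form of
  \<open>data_dd_linear_mult\<close>, which permits induction on the degree.\<close>

lemma trunc_data_Suc:
  "trunc_data (Suc k) y i t = (t - y) * trunc_data k y i t + real i * trunc_data k y (i - 1) t"
  by (simp add: trunc_data_def higher_pderiv_linear_mult del: mult_pCons_left)

lemma higher_pderiv_linear_power:
  "(pderiv ^^ i) ([:- y, 1:] ^ k) = smult (\<Prod>l<i. real k - real l) ([:- y, 1:] ^ (k - i))"
proof (induction i)
  case (Suc i)
  show ?case
  proof (cases "i \<le> k")
    case True
    then show ?thesis
      by (simp add: Suc.IH pderiv_smult pderiv_power pderiv_pCons of_nat_diff)
  next
    case False
    then have "(\<Prod>l<i. real k - real l) = 0" by (intro prod_zero) (auto intro!: bexI[of _ k])
    then show ?thesis by (simp add: Suc.IH)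
  qed
qed simp

lemma higher_deriv_trunc_power_eq_data:
  assumes "t \<noteq> y \<or> i = 0"
  shows "(deriv ^^ i) (\<lambda>t. trunc_power k (t - y)) t = trunc_data k y i t"
proof (cases "t = y")
  case True
  with assms show ?thesis by (simp add: trunc_power_def trunc_data_def)
next
  case False
  then show ?thesis
    by (simp add: higher_deriv_trunc_power trunc_data_def higher_pderiv_linear_power)
qed

definition trunc_dd :: "nat \<Rightarrow> real \<Rightarrow> real list \<Rightarrow> real" where
  "trunc_dd k y ts = data_dd ts (trunc_data k y)"

text \<open>If \<open>y\<close> is a node at all, it carries only the condition of order 0, where
  the function and the convention in \<open>trunc_data\<close> agree.\<close>

lemma divided_difference_trunc_power:
  assumes "count_list ts y \<le> 1"
  shows "divided_difference ts (\<lambda>t. trunc_power k (t - y)) = trunc_dd k y ts"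
  unfolding divided_difference_eq_data_dd trunc_dd_def
  using assms by (intro data_dd_cong higher_deriv_trunc_power_eq_data) (metis less_one order_less_le_trans)

text \<open>To the right of \<open>y\<close> the truncated power is the monic polynomial
  \<open>(t - y) ^ k\<close>, which is its own interpolant.\<close>

lemma trunc_dd_above:
  assumes "\<And>t. t \<in> set ts \<Longrightarrow> t > y" "k < length ts"
  shows "trunc_dd k y ts = (if length ts = Suc k then 1 else 0)"
proof -
  have deg: "degree ([:- y, 1:] ^ k) = k" by (rule degree_linear_power)
  have "interp_data ts (trunc_data k y) ([:- y, 1:] ^ k)"
    using assms by (auto simp: interp_data_def trunc_data_def deg)
  from data_dd_eq[OF this] show ?thesis
    using assms(2) by (auto simp: trunc_dd_def coeff_linear_power intro!: coeff_eq_0 simp: deg)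
qed

lemma trunc_dd_below:
  assumes "\<And>t. t \<in> set ts \<Longrightarrow> t \<le> y" "ts \<noteq> []"
  shows "trunc_dd k y ts = 0"
proof -
  have "interp_data ts (trunc_data k y) 0"
    using assms by (auto simp: interp_data_def trunc_data_def dest: leD)
  from data_dd_eq[OF this] show ?thesis by (simp add: trunc_dd_def)
qed

lemma trunc_dd_recurrence:
  assumes "a \<noteq> b"
  shows "(b - a) * trunc_dd k y (a # ts @ [b]) = trunc_dd k y (ts @ [b]) - trunc_dd k y (a # ts)"
  unfolding trunc_dd_def by (rule data_dd_recurrence[OF assms])

text \<open>Leibniz' rule with the factor \<open>t - y\<close> lowers the degree; the recurrence for
  divided differences then removes the longest list.\<close>

lemma trunc_dd_cox_de_boor:
  assumes "a \<noteq> b"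
  shows "(b - a) * trunc_dd (Suc k) y (a # ts @ [b]) =
    (y - a) * trunc_dd k y (a # ts) + (b - y) * trunc_dd k y (ts @ [b])"
proof -
  have eq: "trunc_dd (Suc k) y (a # ts @ [b]) = (a - y) * trunc_dd k y (a # ts @ [b]) + trunc_dd k y (ts @ [b])"
    using data_dd_linear_mult[of "ts @ [b]" a y "trunc_data k y"]
    by (simp add: trunc_dd_def trunc_data_Suc[abs_def])
  have "(b - a) * trunc_dd (Suc k) y (a # ts @ [b]) =
      (a - y) * ((b - a) * trunc_dd k y (a # ts @ [b])) + (b - a) * trunc_dd k y (ts @ [b])"
    unfolding eq by (simp add: algebra_simps)
  then show ?thesis
    unfolding trunc_dd_recurrence[OF assms] by (simp add: algebra_simps)
qed

section \<open>B-splines\<close>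

locale knots =
  fixes n k :: nat and x :: "int \<Rightarrow> real"
  assumes n_pos: "n > 0" and k_pos: "k > 0" and knots: "knot_sequence n k x"
begin

section \<open>Order and multiplicity of the knots\<close>

lemma knot_eq_0: "i \<in> {- int k..0} \<Longrightarrow> x i = 0"
  and knot_eq_1: "i \<in> {int n..int n + int k} \<Longrightarrow> x i = 1"
  using knots by (auto simp: knot_sequence_def)

text \<open>The bounds \<open>i < int n\<close> and \<open>0 < j\<close> exclude exactly the pairs
  lying in the same block of repeated end knots.\<close>

lemma knot_less:
  assumes "i < j" "- int k \<le> i" "i < int n" "0 < j" "j \<le> int n + int k"
  shows "x i < x j"
proof -
  have i: "i \<in> {- int k..int n + int k}" and j: "j \<in> {- int k..int n + int k}" using assms by auto
  show ?thesis
  proof (cases "0 \<le> i \<and> j \<le> int n")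
    case True
    then show ?thesis using assms knots by (auto simp: knot_sequence_def strict_mono_on_def)
  next
    case False
    then show ?thesis
      using assms by (cases rule: knot_sequence_cases[OF knots i]; cases rule: knot_sequence_cases[OF knots j]) auto
  qed
qed

lemma knot_mono:
  assumes "i \<le> j" "- int k \<le> i" "j \<le> int n + int k"
  shows "x i \<le> x j"
proof -
  consider "i = j" | "j \<le> 0" | "i \<ge> int n" | "i < j" "i < int n" "0 < j" using assms(1) by linarith
  then show ?thesis
    using knot_less[of i j] knot_eq_0[of i] knot_eq_0[of j] knot_eq_1[of i] knot_eq_1[of j] assms
    by cases auto
qed

lemma count_knots_le_1:
  assumes "0 < y" "y < 1" "- int k \<le> a" "b \<le> int n + int k"
  shows "count_list (map x [a..b]) y \<le> 1"
proof (rule count_list_map_le_1)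
  have in01: "i \<in> {0<..<int n}" if "i \<in> set [a..b]" "x i = y" for i
  proof -
    have "i \<in> {- int k..int n + int k}" using that assms by auto
    then show ?thesis by (rule knot_sequence_cases[OF knots]) (use that assms in auto)
  qed
  fix i i' assume "i \<in> set [a..b]" "i' \<in> set [a..b]" "x i = y" "x i' = y"
  with in01[of i] in01[of i'] show "i = i'"
    using knot_less[of i i'] knot_less[of i' i] by (cases i i' rule: linorder_cases) auto
qed simp

text \<open>The B-spline of degree \<open>d\<close> without the factor \<open>x (j + d + 1) - x j\<close>, on the same knots
  for every degree; it vanishes if all its knots coincide.\<close>

definition mspline :: "nat \<Rightarrow> int \<Rightarrow> real \<Rightarrow> real" where
  "mspline d j y = trunc_dd d y (map x [j..j + int d + 1])"

lemma map_knots_Cons: "i \<le> j \<Longrightarrow> map x [i..j] = x i # map x [i + 1..j]"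
  by (simp add: upto_rec1)

lemma map_knots_snoc: "i \<le> j \<Longrightarrow> map x [i..j] = map x [i..j - 1] @ [x j]"
  by (simp add: upto_rec2)

lemma map_knots_Cons_snoc:
  "map x [j..j + int d + 1] = x j # map x [j + 1..j + int d] @ [x (j + int d + 1)]"
  using map_knots_Cons[of j "j + int d + 1"] map_knots_snoc[of "j + 1" "j + int d + 1"] by simp

text \<open>Exhibits the normalized spline as a difference of consecutive divided differences, ready
  for telescoping.\<close>

lemma mspline_recurrence:
  assumes "x j \<noteq> x (j + int d + 1)"
  shows "(x (j + int d + 1) - x j) * mspline d j y =
    trunc_dd d y (map x [j + 1..j + int d + 1]) - trunc_dd d y (map x [j..j + int d])"
  using trunc_dd_recurrence[OF assms, of d y "map x [j + 1..j + int d]"]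
    map_knots_Cons[of j "j + int d"] map_knots_snoc[of "j + 1" "j + int d + 1"]
  by (simp add: mspline_def map_knots_Cons_snoc)

lemma mspline_Suc:
  assumes "x j \<noteq> x (j + int d + 2)"
  shows "(x (j + int d + 2) - x j) * mspline (Suc d) j y =
    (y - x j) * mspline d j y + (x (j + int d + 2) - y) * mspline d (j + 1) y"
  using trunc_dd_cox_de_boor[OF assms, of d y "map x [j + 1..j + int d + 1]"]
    map_knots_Cons[of j "j + int d + 1"] map_knots_snoc[of "j + 1" "j + int d + 2"]
    map_knots_Cons_snoc[of j "Suc d"]
  by (simp add: mspline_def algebra_simps)

lemma mspline_eq_0_left:
  assumes "- int k \<le> j" "j + int d + 1 \<le> int n + int k" "y < x j"
  shows "mspline d j y = 0"
proof -
  have "y < x i" if "i \<in> {j..j + int d + 1}" for i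
    using knot_mono[of j i] that assms by auto
  then show ?thesis unfolding mspline_def by (subst trunc_dd_above) auto
qed

lemma mspline_eq_0_right:
  assumes "- int k \<le> j" "j + int d + 1 \<le> int n + int k" "x (j + int d + 1) \<le> y"
  shows "mspline d j y = 0"
proof -
  have "x i \<le> y" if "i \<in> {j..j + int d + 1}" for i
    using knot_mono[of i "j + int d + 1"] that assms by auto
  then show ?thesis unfolding mspline_def by (intro trunc_dd_below) auto
qed

lemma mspline_0:
  assumes "x j \<le> y" "y < x (j + 1)"
  shows "(x (j + 1) - x j) * mspline 0 j y = 1"
  using mspline_recurrence[of j 0 y] trunc_dd_above[of "[x (j + 1)]" y 0] trunc_dd_below[of "[x j]" y 0] assms
  by simp

text \<open>Between the outer knots both weights of the Cox-de Boor recursion are nonnegative;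
  elsewhere the spline is 0.\<close>

lemma mspline_nonneg:
  assumes "- int k \<le> j" "j + int d + 1 \<le> int n + int k"
  shows "mspline d j y \<ge> 0"
  using assms
proof (induction d arbitrary: j)
  case 0
  show ?case
  proof (cases "x j \<le> y \<and> y < x (j + 1)")
    case True
    then have "(x (j + 1) - x j) * mspline 0 j y > 0" using mspline_0 by simp
    then show ?thesis using True by (simp add: zero_less_mult_iff)
  next
    case False
    then show ?thesis using mspline_eq_0_left[of j 0 y] mspline_eq_0_right[of j 0 y] 0 by force
  qed
next
  case (Suc d)
  show ?case
  proof (cases "x j \<le> y \<and> y < x (j + int d + 2)")
    case True
    have "mspline d j y \<ge> 0" "mspline d (j + 1) y \<ge> 0" using Suc by auto
    then have "(x (j + int d + 2) - x j) * mspline (Suc d) j y \<ge> 0"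
      using True by (subst mspline_Suc) auto
    then show ?thesis using True by (simp add: zero_le_mult_iff)
  next
    case False
    then show ?thesis using mspline_eq_0_left[of j "Suc d" y] mspline_eq_0_right[of j "Suc d" y] Suc.prems
      by (force simp: algebra_simps)
  qed
qed

text \<open>By the Cox-de Boor recursion it is enough that one of the two splines of lower degree is
  positive. Degree 0 is positive already at its left knot, whereas higher degrees need not be; hence
  the disjunction in the hypotheses.\<close>

lemma mspline_pos:
  assumes "- int k \<le> j" "j + int d + 1 \<le> int n + int k" "0 < y" "y < 1"
    and "x j \<le> y" "d = 0 \<or> x j < y" "y < x (j + int d + 1)"
  shows "mspline d j y > 0"
  using assms
proof (induction d arbitrary: j)
  case 0
  then have "(x (j + 1) - x j) * mspline 0 j y > 0" using mspline_0[of j y] by simp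
  then show ?case using 0 by (simp add: zero_less_mult_iff)
next
  case (Suc d)
  have lt: "x j < y" "y < x (j + int d + 2)" using Suc.prems by (auto simp: algebra_simps)
  have nonneg: "mspline d j y \<ge> 0" "mspline d (j + 1) y \<ge> 0" using Suc.prems by (auto intro!: mspline_nonneg)
  have "mspline d j y > 0 \<or> mspline d (j + 1) y > 0"
  proof (cases "y < x (j + int d + 1)")
    case True
    then show ?thesis using Suc.IH[of j] Suc.prems by simp
  next
    case False
    have *: "x (j + 1) \<le> x (j + int d + 1)" using Suc.prems by (intro knot_mono) auto
    have "x (j + 1) \<le> y" using False * by linarith
    moreover have "d = 0 \<or> x (j + 1) < y"
    \<comment> \<open>Otherwise \<open>d > 0\<close> and the knots \<open>j + 1\<close> to
      \<open>j + d + 1\<close>, at least two of them, would all equal \<open>y\<close>; but knots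
      strictly between 0 and 1 are simple.\<close>
    proof (rule ccontr)
      assume "\<not> ?thesis"
      then have "d > 0" "x (j + 1) = y" "x (j + int d + 1) = y" using False * calculation by auto
      moreover from this have "j + 1 \<in> {- int k..int n + int k}" "j + int d + 1 \<in> {- int k..int n + int k}"
        using Suc.prems by auto
      then have "j + 1 < int n" "j + int d + 1 > 0"
        using Suc.prems knot_eq_0[of "j + int d + 1"] knot_eq_1[of "j + 1"] calculation by force+
      ultimately show False using knot_less[of "j + 1" "j + int d + 1"] Suc.prems by auto
    qed
    ultimately show ?thesis using Suc.IH[of "j + 1"] Suc.prems lt by (simp add: algebra_simps)
  qed
  then have "(y - x j) * mspline d j y > 0 \<or> (x (j + int d + 2) - y) * mspline d (j + 1) y > 0"
    using lt by (auto intro: mult_pos_pos)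
  moreover have "(y - x j) * mspline d j y \<ge> 0" "(x (j + int d + 2) - y) * mspline d (j + 1) y \<ge> 0"
    using lt nonneg by simp_all
  ultimately have "(x (j + int d + 2) - x j) * mspline (Suc d) j y > 0"
    using lt by (subst mspline_Suc) auto
  then show ?case using lt by (simp add: zero_less_mult_iff)
qed

text \<open>For \<open>y\<close> strictly inside the interval at most one knot equals
  \<open>y\<close>, so genuine derivatives may be replaced by \<open>trunc_data\<close>.\<close>

lemma bspline_pre_eq_mspline:
  assumes "0 < y" "y < 1" "j \<in> {- int k..int n - 1}"
  shows "bspline_pre k x j y = (x (j + int k + 1) - x j) * mspline k j y"
  using assms count_knots_le_1[of y j "j + int k + 1"]
  by (simp add: bspline_pre_def mspline_def divided_difference_trunc_power)

lemma bspline_pre_nonneg: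
  assumes "0 < y" "y < 1" "j \<in> {- int k..int n - 1}"
  shows "bspline_pre k x j y \<ge> 0"
  using assms knot_mono[of j "j + int k + 1"] mspline_nonneg[of j k y]
  by (simp add: bspline_pre_eq_mspline)

lemma bspline_pre_pos:
  assumes "j \<in> {- int k..int n - 1}" "0 < y" "y < 1" "x j < y" "y < x (j + int k + 1)"
  shows "bspline_pre k x j y > 0"
  using assms mspline_pos[of j k y] by (simp add: bspline_pre_eq_mspline)

section \<open>Partition of unity and B-splines near the endpoints\<close>

lemma sum_telescope_int:
  fixes F :: "int \<Rightarrow> real"
  assumes "a \<le> b"
  shows "(\<Sum>j=a..b - 1. F (j + 1) - F j) = F b - F a"
  using assms
proof (induction b rule: int_ge_induct)
  case (step i)
  have "{a..i} = insert i {a..i - 1}" using step.hyps by auto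
  then show ?case using step.IH by simp
qed simp

text \<open>The telescoping sum leaves two lists of \<open>k + 1\<close> equal knots: those at 1
  give 1, those at 0 give 0.\<close>

lemma sum_bspline_pre:
  assumes "0 < y" "y < 1"
  shows "(\<Sum>j=- int k..int n - 1. bspline_pre k x j y) = 1"
proof -
  define F where "F = (\<lambda>j. trunc_dd k y (map x [j..j + int k]))"
  have "bspline_pre k x j y = F (j + 1) - F j" if j: "j \<in> {- int k..int n - 1}" for j
  proof -
    have "x j < x (j + int k + 1)" using j by (intro knot_less) auto
    then show ?thesis
      using assms j mspline_recurrence[of j k y] by (simp add: bspline_pre_eq_mspline F_def algebra_simps)
  qed
  then have "(\<Sum>j=- int k..int n - 1. bspline_pre k x j y) = F (int n) - F (- int k)"
    using sum_telescope_int[of "- int k" "int n" F] by simp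
  moreover have "F (int n) = 1"
    unfolding F_def using assms knot_eq_1 by (subst trunc_dd_above) auto
  moreover have "F (- int k) = 0"
    unfolding F_def using assms knot_eq_0 by (intro trunc_dd_below) auto
  ultimately show ?thesis by simp
qed

text \<open>Used for the limit 1 at the left endpoint. Lowering the index as the degree grows keeps
  the last knot at \<open>x 1\<close>, so each step multiplies by
  \<open>(x 1 - y) / x 1\<close>.\<close>

lemma bspline_pre_first:
  assumes "0 < y" "y < x 1"
  shows "bspline_pre k x (- int k) y = ((x 1 - y) / x 1) ^ k"
proof -
  have x0: "x (- int d) = 0" if "d \<le> k" for d using knot_eq_0[of "- int d"] that by simp
  have "x 1 * mspline d (- int d) y = ((x 1 - y) / x 1) ^ d" if "d \<le> k" for d
    using that
  proof (induction d)
    case 0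
    then show ?case using mspline_0[of 0 y] knot_eq_0[of 0] assms by simp
  next
    case (Suc d)
    \<comment> \<open>All knots of this spline are 0, so one term of the recursion drops
      out.\<close>
    have "mspline d (- 1 - int d) y = 0"
      using mspline_eq_0_right[of "- 1 - int d" d y] Suc.prems assms knot_eq_0[of 0] by simp
    then have "x 1 * mspline (Suc d) (- int (Suc d)) y = (x 1 - y) * mspline d (- int d) y"
      using mspline_Suc[of "- int (Suc d)" d y] x0[OF Suc.prems] assms by (simp add: algebra_simps)
    also have "\<dots> = (x 1 - y) / x 1 * (x 1 * mspline d (- int d) y)" using assms by simp
    finally show ?case using Suc by simp
  qed
  moreover have "x 1 \<le> 1" using knot_mono[of 1 "int n"] knot_eq_1[of "int n"] n_pos by simp
  ultimately show ?thesis
    using assms n_pos x0[of k] by (simp add: bspline_pre_eq_mspline)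
qed

text \<open>Mirror image at the right endpoint: here the index stays fixed and the knots added with
  the degree all equal 1.\<close>

lemma bspline_pre_last:
  assumes "x (int n - 1) < y" "y < 1"
  shows "bspline_pre k x (int n - 1) y = ((y - x (int n - 1)) / (1 - x (int n - 1))) ^ k"
proof -
  let ?a = "x (int n - 1)"
  have xn: "x (int n + int d) = 1" if "d \<le> k" for d using knot_eq_1[of "int n + int d"] that by simp
  have "(1 - ?a) * mspline d (int n - 1) y = ((y - ?a) / (1 - ?a)) ^ d" if "d \<le> k" for d
    using that
  proof (induction d)
    case 0
    then show ?case using mspline_0[of "int n - 1" y] xn[of 0] assms by simp
  next
    case (Suc d)
    have "mspline d (int n) y = 0"
      using mspline_eq_0_left[of "int n" d y] Suc.prems assms xn[of 0] by simp
    then have "(1 - ?a) * mspline (Suc d) (int n - 1) y = (y - ?a) * mspline d (int n - 1) y"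
      using mspline_Suc[of "int n - 1" d y] xn[OF Suc.prems] assms by (simp add: algebra_simps)
    also have "\<dots> = (y - ?a) / (1 - ?a) * ((1 - ?a) * mspline d (int n - 1) y)" using assms by simp
    finally show ?case using Suc by simp
  qed
  moreover have "0 \<le> ?a" using knot_mono[of 0 "int n - 1"] knot_eq_0[of 0] n_pos by simp
  ultimately show ?thesis
    using assms n_pos xn[of k] by (simp add: bspline_pre_eq_mspline)
qed

section \<open>Location of the Greville nodes\<close>

lemma greville_first: "greville k x (- int k) = 0"
  unfolding greville_def using knot_eq_0 by (simp add: sum.neutral)

lemma greville_last: "greville k x (int n - 1) = 1"
  unfolding greville_def using knot_eq_1 k_pos by simp

text \<open>The node is the mean of knots lying between the two bounds. For an inner index
  \<open>j\<close> the last of them exceeds \<open>x j\<close> and the first is below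
  \<open>x (j + int k + 1)\<close>, which makes both inequalities strict.\<close>

lemma greville_between:
  assumes "- int k < j" "j < int n - 1"
  shows "x j < greville k x j" "greville k x j < x (j + int k + 1)"
proof -
  let ?I = "{j + 1..j + int k}"
  have "(\<Sum>i\<in>?I. x j) < (\<Sum>i\<in>?I. x i)"
  proof (rule sum_strict_mono_ex1)
    show "\<forall>i\<in>?I. x j \<le> x i" using assms by (auto intro!: knot_mono)
    show "\<exists>i\<in>?I. x j < x i"
      using assms k_pos by (intro bexI[of _ "j + int k"] knot_less) auto
  qed simp
  then show "x j < greville k x j" using k_pos by (simp add: greville_def field_simps)
  have "(\<Sum>i\<in>?I. x i) < (\<Sum>i\<in>?I. x (j + int k + 1))"
  proof (rule sum_strict_mono_ex1)
    show "\<forall>i\<in>?I. x i \<le> x (j + int k + 1)" using assms by (auto intro!: knot_mono)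
    show "\<exists>i\<in>?I. x i < x (j + int k + 1)"
      using assms k_pos by (intro bexI[of _ "j + 1"] knot_less) auto
  qed simp
  then show "greville k x j < x (j + int k + 1)" using k_pos by (simp add: greville_def field_simps)
qed

section \<open>The Schoenberg operator\<close>

lemma eq_on_unit_if_eq_interior:
  fixes F G :: "real \<Rightarrow> real"
  assumes "continuous_on {0..1} F" "continuous_on {0..1} G"
    "\<And>y. 0 < y \<Longrightarrow> y < 1 \<Longrightarrow> F y = G y" "y \<in> {0..1}"
  shows "F y = G y"
proof -
  have "F y - G y = 0"
    by (rule continuous_constant_on_closure[where S = "{0<..<1}" and f = "\<lambda>y. F y - G y"])
      (use assms in \<open>auto intro!: continuous_intros\<close>)
  then show ?thesis by simp
qed

text \<open>\<open>H j\<close> extends the B-spline continuously from the open interval to its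
  endpoints. Identities and weak inequalities pass to the closure; positivity at the two extreme
  nodes needs the actual limits.\<close>

lemma schoenberg_representation:
  obtains H where "\<And>j. j \<in> {- int k..int n - 1} \<Longrightarrow> continuous_on {0..1} (H j)"
    and "\<And>j y. j \<in> {- int k..int n - 1} \<Longrightarrow> y \<in> {0..1} \<Longrightarrow> H j y \<ge> 0"
    and "\<And>y. y \<in> {0..1} \<Longrightarrow> (\<Sum>j=- int k..int n - 1. H j y) = 1"
    and "\<And>j. j \<in> {- int k..int n - 1} \<Longrightarrow> H j (greville k x j) > 0"
    and "\<And>f t. apply_bcontfun (schoenberg n k x f) t =
      (\<Sum>j=- int k..int n - 1. apply_bcontfun f (unit_of_real (greville k x j)) * H j (real_of_unit t))"
proof -
  let ?J = "{- int k..int n - 1}"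
  have "\<forall>j\<in>?J. \<exists>H. continuous_on UNIV H \<and> (\<forall>y\<in>{0<..<1}. bspline_pre k x j y = H y)"
    using bspline_pre_continuous[OF knots k_pos] by metis
  then obtain H where cont_UNIV: "\<And>j. j \<in> ?J \<Longrightarrow> continuous_on UNIV (H j)"
    and pre: "\<And>j y. j \<in> ?J \<Longrightarrow> 0 < y \<Longrightarrow> y < 1 \<Longrightarrow> H j y = bspline_pre k x j y"
    by (metis greaterThanLessThan_iff)
  then have cont: "continuous_on A (H j)" if "j \<in> ?J" for j A
    using that continuous_on_subset by blast
  have nonneg: "H j y \<ge> 0" if "j \<in> ?J" "y \<in> {0..1}" for j y
    by (rule continuous_ge_on_closure[where S = "{0<..<1}" and f = "H j"])
      (use that in \<open>auto intro: cont simp: pre bspline_pre_nonneg\<close>)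
  have sum: "(\<Sum>j\<in>?J. H j y) = 1" if "y \<in> {0..1}" for y
    by (rule eq_on_unit_if_eq_interior[of "\<lambda>y. \<Sum>j\<in>?J. H j y" "\<lambda>y. 1"])
      (use that in \<open>auto intro!: continuous_intros cont simp: pre sum_bspline_pre\<close>)
  \<comment> \<open>The first Greville node is 0 itself, where a limit of positive values could
    vanish; the explicit formula near 0 settles it.\<close>
  have first: "H (- int k) 0 = 1"
  proof -
    have x1: "0 < x 1" "x 1 \<le> 1"
      using knot_less[of 0 1] knot_eq_0[of 0] knot_mono[of 1 "int n"] knot_eq_1[of "int n"] n_pos by auto
    then have cl: "closure {0<..<x 1} = {0..x 1}" by simp
    have "H (- int k) 0 - ((x 1 - 0) / x 1) ^ k = 0"
      by (rule continuous_constant_on_closure[where S = "{0<..<x 1}" and f = "\<lambda>y. H (- int k) y - ((x 1 - y) / x 1) ^ k"])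
        (use x1 n_pos in \<open>auto intro!: continuous_intros cont simp: cl pre bspline_pre_first\<close>)
    then show ?thesis using x1 by simp
  qed
  have last: "H (int n - 1) 1 = 1"
  proof -
    let ?a = "x (int n - 1)"
    have a: "0 \<le> ?a" "?a < 1"
      using knot_less[of "int n - 1" "int n"] knot_eq_0[of 0] knot_mono[of 0 "int n - 1"] knot_eq_1[of "int n"] n_pos
      by auto
    then have cl: "closure {?a<..<1} = {?a..1}" by simp
    have "H (int n - 1) 1 - ((1 - ?a) / (1 - ?a)) ^ k = 0"
      by (rule continuous_constant_on_closure[where S = "{?a<..<1}" and f = "\<lambda>y. H (int n - 1) y - ((y - ?a) / (1 - ?a)) ^ k"])
        (use a n_pos in \<open>auto intro!: continuous_intros cont simp: cl pre bspline_pre_last\<close>)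
    then show ?thesis using a by simp
  qed
  have diag: "H j (greville k x j) > 0" if j: "j \<in> ?J" for j
  proof -
    consider "j = - int k" | "j = int n - 1" | "- int k < j" "j < int n - 1" using j by force
    then show ?thesis
    proof cases
      case 3
      note between = greville_between[OF this]
      have "x j \<ge> 0" using knot_mono[of "- int k" j] knot_eq_0[of "- int k"] j by simp
      moreover have "x (j + int k + 1) \<le> 1"
        using knot_mono[of "j + int k + 1" "int n + int k"] knot_eq_1[of "int n + int k"] j by simp
      ultimately show ?thesis
        using between j by (subst pre) (auto intro!: bspline_pre_pos)
    qed (simp_all add: greville_first greville_last first last)
  qed
  have repr: "apply_bcontfun (schoenberg n k x f) t =
      (\<Sum>j\<in>?J. apply_bcontfun f (unit_of_real (greville k x j)) * H j (real_of_unit t))" for f t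
  proof -
    let ?S = "\<lambda>y. apply_bcontfun (schoenberg n k x f) (unit_of_real y)"
    have "?S (real_of_unit t) =
      (\<Sum>j\<in>?J. apply_bcontfun f (unit_of_real (greville k x j)) * H j (real_of_unit t))"
    \<comment> \<open>Both sides are continuous, so comparing them at interior points also covers
      the endpoint values defined by limits.\<close>
    proof (rule eq_on_unit_if_eq_interior[of ?S])
      show "continuous_on {0..1} ?S"
        by (rule continuous_on_compose2[OF _ continuous_on_unit_of_real])
          (auto intro: continuous_on_apply_bcontfun)
      show "?S y = (\<Sum>j\<in>?J. apply_bcontfun f (unit_of_real (greville k x j)) * H j y)"
        if "0 < y" "y < 1" for y
        using that pre by (simp add: apply_schoenberg[OF knots n_pos k_pos] unit_of_real_inverse
            schoenberg_fun_def schoenberg_sum_def bspline_def)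
    qed (use real_of_unit[of t] in \<open>auto intro!: continuous_intros cont\<close>)
    then show ?thesis by (simp add: real_of_unit_inverse)
  qed
  show thesis by (rule that[OF cont nonneg sum diag repr])
qed

end

section \<open>Spectrum of the Schoenberg operator\<close>

theorem theorem3:
  fixes n k :: nat and x :: "int \<Rightarrow> real"
  assumes "n > 0" and "k > 0"
    and "knot_sequence n k x"
  shows "spectrum (schoenberg n k x) = point_spectrum (schoenberg n k x) \<and>
    spectrum (schoenberg n k x) \<subseteq> {l. cmod l < 1} \<union> {1}"
proof -
  interpret knots n k x using assms by unfold_locales
  let ?J = "{- int k..int n - 1}"
  obtain H where cont: "\<And>j. j \<in> ?J \<Longrightarrow> continuous_on {0..1} (H j)"
    and nonneg: "\<And>j y. j \<in> ?J \<Longrightarrow> y \<in> {0..1} \<Longrightarrow> H j y \<ge> 0"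
    and sum: "\<And>y. y \<in> {0..1} \<Longrightarrow> (\<Sum>j\<in>?J. H j y) = 1"
    and diag: "\<And>j. j \<in> ?J \<Longrightarrow> H j (greville k x j) > 0"
    and repr: "\<And>f t. apply_bcontfun (schoenberg n k x f) t =
      (\<Sum>j\<in>?J. apply_bcontfun f (unit_of_real (greville k x j)) * H j (real_of_unit t))"
    using schoenberg_representation by blast
  define h where "h = (\<lambda>j. Bcontfun (\<lambda>t. H j (real_of_unit t)))"
  have h: "apply_bcontfun (h j) t = H j (real_of_unit t)" if "j \<in> ?J" for j t
  proof -
    have "continuous_on UNIV (\<lambda>t. H j (real_of_unit t))"
      by (rule continuous_on_compose2[OF cont[OF that] continuous_on_real_of_unit]) (use real_of_unit in auto)
    then show ?thesis by (simp add: h_def Bcontfun_inverse bcontfun_unit_interval_iff)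
  qed
  define p where "p = (\<lambda>j. unit_of_real (greville k x j))"
  have p: "real_of_unit (p j) = greville k x j" if "j \<in> ?J" for j
    using greville_mem[OF assms(3,2) that] by (simp add: p_def unit_of_real_inverse)
  interpret finite_rank_op "schoenberg n k x" ?J p h
    by unfold_locales (auto intro!: bcontfun_eqI sum.cong simp: repr h p_def)
  \<comment> \<open>A polynomial vanishing on [0,1] exactly at the finitely many Greville nodes; it
    witnesses the eigenvalue 0.\<close>
  define g where "g = Bcontfun (\<lambda>t. \<Prod>j\<in>?J. real_of_unit t - greville k x j)"
  have g: "apply_bcontfun g t = (\<Prod>j\<in>?J. real_of_unit t - greville k x j)" for t
    unfolding g_def by (subst Bcontfun_inverse) (auto simp: bcontfun_unit_interval_iff intro!: continuous_intros)
  have "infinite ({0..1} - greville k x ` ?J)" by (rule Diff_infinite_finite) simp_all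
  then have "{0..1} - greville k x ` ?J \<noteq> {}" by (metis finite.emptyI)
  then obtain y where "y \<in> {0..1}" "y \<notin> greville k x ` ?J" by blast
  then have "apply_bcontfun g (unit_of_real y) \<noteq> 0" by (auto simp: g unit_of_real_inverse)
  then have "g \<noteq> 0" by auto
  moreover have "apply_bcontfun g (p j) = 0" if "j \<in> ?J" for j
    using that by (auto simp: g p)
  ultimately have "spectrum (schoenberg n k x) = point_spectrum (schoenberg n k x)"
    by (rule spectrum_eq_point_spectrum)
  moreover have "point_spectrum (schoenberg n k x) \<subseteq> {l. cmod l < 1} \<union> {1}"
  proof (rule point_spectrum_stochastic)
    fix i assume i: "i \<in> ?J"
    have mem: "greville k x i \<in> {0..1}" using greville_mem[OF assms(3,2) i] .
    show "apply_bcontfun (h j) (p i) \<ge> 0" if "j \<in> ?J" for j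
      using nonneg[OF that mem] by (simp only: h[OF that] p[OF i])
    show "(\<Sum>j\<in>?J. apply_bcontfun (h j) (p i)) = 1"
      using sum[OF mem] by (simp add: h p[OF i])
    show "apply_bcontfun (h i) (p i) > 0"
      using diag[OF i] by (simp only: h[OF i] p[OF i])
  qed
  ultimately show ?thesis by simp
qed

end
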